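(* Let $\mathbb{H}^N$ be the Heisenberg group with homogeneous dimension $Q=2N+2$, let $\lambda\in\big(0,\big(\tfrac{Q-2}{2}\big)^2\big)$, $\gamma\in[0,1)$, $\alpha\in(-1,0)$, and $$p\in\left(1,\frac{Q+2\gamma-\mu(\lambda)-2\alpha}{Q-2-\mu(\lambda)-2\alpha}\right).$$ Assume that $u_0\in L^\infty(\mathbb{H}^N)$ with $u_0\ge0$, that $0<\int_{\mathbb{H}^N}\|\xi\|_H^{-\mu(\lambda)}f(\xi)\,d\xi<\infty$, and that $$f(\xi)\ge\varepsilon\|\xi\|_H^{-2\beta}\ \text{ for }\|\xi\|_H\ge1,\qquad \beta\in\left(\frac{Q}{2}-\frac{\mu(\lambda)}{2},\ \frac{\gamma+p}{p-1}+\alpha\right),\quad \varepsilon>0 .$$ Let $T_\varepsilon$ denote the maximal existence time, $T_\varepsilon=\sup\{T>0:\ \text{the problem below admits a weak solution in }\mathbb{H}^N\times[0,T)\}$, for the problem $$\partial_tu-\Delta_{H}u=\lambda \frac{\psi u}{\|\cdot\|_{H}^{2}}+\frac{1}{\Gamma(\gamma)}\int_0^t(t-\tau)^{\gamma-1}|u(\tau)|^{p}\,d\tau+t^\alpha f \ \text{ in } \mathbb{H}^N\times(0,T),\qquad u(\cdot,0)=u_0 \ \text{ in } \mathbb{H}^N.$$ Then, for any local-in-time solution $u_\varepsilon$ to this problem, the following estimate on $T_\varepsilon$ is valid: $$T_\varepsilon\le C\,\varepsilon^{\left(\beta-\frac{\gamma+p}{p-1}-\alpha\right)^{-1}},$$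 for some constant $C>0$ independent of $T_\varepsilon$.
   Context: **Heisenberg group.** $\mathbb{H}^N$ is $\mathbb{R}^{2N+1}$ with points $\xi=(x,y,w)$, $x,y\in\mathbb{R}^N$, $w\in\mathbb{R}$, and group law $(x,y,w)\circ(x',y',w')=(x+x',y+y',w+w'+2\langle y,x'\rangle-2\langle x,y'\rangle)$. $Q=2N+2$. $d\xi$ is Lebesgue measure on $\mathbb{R}^{2N+1}$. Let $X_i=\partial_{x_i}+2y_i\partial_w$, $Y_i=\partial_{y_i}-2x_i\partial_w$ ($1\le i\le N$); $\nabla_H u=(X_1u,\dots,X_Nu,Y_1u,\dots,Y_Nu)$; $\Delta_H=\sum_{i=1}^N(X_i^2+Y_i^2)$; $\nabla_H\cdot$ denotes the corresponding horizontal divergence. The Korányi norm is $\|\xi\|_H=\big[\big(\sum_{i=1}^N(x_i^2+y_i^2)\big)^2+w^2\big]^{1/4}$, and $\psi=\big|\nabla_H\|\cdot\|_H\big|^2$. **Constant $\mu(\lambda)$.** For $\lambda\in(0,(\frac{Q-2}{2})^2)$, $\mu(\lambda)=\frac{Q-2}{2}-\sqrt{\big(\frac{Q-2}{2}\big)^2-\lambda}$. **Memory term.** For $\gamma\in(0,1)$, $I_{T^-}^\gamma\phi(t)=\frac{1}{\Gamma(\gamma)}\int_t^T(\tau-t)^{\gamma-1}\phi(\tau)\,d\tau$, and $I^0_{T^-}\phi=\phi$. Correspondingly, for $\gamma=0$ the term $\frac{1}{\Gamma(\gamma)}\int_0^t(t-\tau)^{\gamma-1}|u(\tau)|^p\,d\tau$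 means $|u(t)|^p$. **Weak solution.** Solutions are understood in the following weak sense. Put $v(\xi,t)=\|\xi\|_H^{\mu(\lambda)}u(\xi,t)$, $v(0,\xi)=\|\xi\|_H^{\mu(\lambda)}u_0(\xi)$, and $L_H\phi=-\nabla_H\cdot\big(\|\cdot\|_H^{-2\mu(\lambda)}\nabla_H\phi\big)$. Let $v(0,\cdot)\in L^1_{\rm loc}(\mathbb{H}^N,\|\xi\|_H^{-2\mu(\lambda)}d\xi)$ and $f\in L^1_{\rm loc}(\mathbb{H}^N,\|\xi\|_H^{-\mu(\lambda)}d\xi)$. The function $v\in L^p_{\rm loc}((0,T),L^p_{\rm loc}(\mathbb{H}^N,\|\xi\|_H^{-(p+1)\mu(\lambda)}d\xi))\cap L^1_{\rm loc}((0,T),L^1_{\rm loc}(\mathbb{H}^N,\|\xi\|_H^{-2\mu(\lambda)}d\xi))$ (equivalently $u$) is a local-in-time weak solution of the problem on $(0,T)$ if $$-\int_0^T\!\!\int_{\mathbb{H}^N}v\big(\|\xi\|_H^{-2\mu(\lambda)}\partial_t\phi-L_H\phi\big)d\xi dt=\int_0^T\!\!\int_{\mathbb{H}^N}\|\xi\|_H^{-(p+1)\mu(\lambda)}|v|^pI^\gamma_{T^-}\phi\,d\xi dt+\int_{\mathbb{H}^N}\|\xi\|_H^{-2\mu(\lambda)}v(0,\xi)\phi(0,\xi)d\xi+\int_0^T\!\!\int_{\mathbb{H}^N}\|\xi\|_H^{-\mu(\lambda)}t^\alpha f\phi\,d\xi dt$$ for every non-negative test function $\phi\in C_c^1([0,T),C_c^2(\mathbb{H}^N))$.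 *)

theory Defs
  imports "HOL-Analysis.Analysis"
begin

text \<open>
  Points \<open>(x, y, w)\<close> of the Heisenberg group of order \<open>N = CARD('n)\<close>; the measure \<open>d\<xi>\<close> is
  \<open>lebesgue\<close> on this Euclidean space.
\<close>

type_synonym 'n heis = "(real ^ 'n) \<times> (real ^ 'n) \<times> real"

definition hdim :: "'n::finite itself \<Rightarrow> real" where
  "hdim _ = 2 * real CARD('n) + 2"

definition hnorm :: "'n::finite heis \<Rightarrow> real" where
  "hnorm \<xi> = (case \<xi> of (x, y, w) \<Rightarrow>
     root 4 ((\<Sum>i\<in>UNIV. (x $ i)\<^sup>2 + (y $ i)\<^sup>2)\<^sup>2 + w\<^sup>2))"

definition pd :: "'a::euclidean_space \<Rightarrow> ('a \<Rightarrow> real) \<Rightarrow> 'a \<Rightarrow> real" where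
  "pd b g \<xi> = frechet_derivative g (at \<xi>) b"

definition hX :: "'n::finite \<Rightarrow> ('n heis \<Rightarrow> real) \<Rightarrow> 'n heis \<Rightarrow> real" where
  "hX i g \<xi> = (case \<xi> of (x, y, w) \<Rightarrow>
     pd (axis i 1, 0, 0) g \<xi> + 2 * (y $ i) * pd (0, 0, 1) g \<xi>)"

definition hY :: "'n::finite \<Rightarrow> ('n heis \<Rightarrow> real) \<Rightarrow> 'n heis \<Rightarrow> real" where
  "hY i g \<xi> = (case \<xi> of (x, y, w) \<Rightarrow>
     pd (0, axis i 1, 0) g \<xi> - 2 * (x $ i) * pd (0, 0, 1) g \<xi>)"

definition hgrad :: "('n::finite heis \<Rightarrow> real) \<Rightarrow> 'n heis \<Rightarrow> (real ^ 'n) \<times> (real ^ 'n)" where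
  "hgrad g \<xi> = (\<chi> i. hX i g \<xi>, \<chi> i. hY i g \<xi>)"

definition hdiv :: "('n::finite heis \<Rightarrow> (real ^ 'n) \<times> (real ^ 'n)) \<Rightarrow> 'n heis \<Rightarrow> real" where
  "hdiv F \<xi> = (\<Sum>i\<in>UNIV. hX i (\<lambda>\<eta>. fst (F \<eta>) $ i) \<xi> + hY i (\<lambda>\<eta>. snd (F \<eta>) $ i) \<xi>)"

text \<open>
  The weighted operator with weight exponent \<open>- 2 * m\<close>. The weight is singular at the origin
  only, so the value of the derivatives there is irrelevant under the integral.
\<close>

definition LH :: "real \<Rightarrow> ('n::finite heis \<Rightarrow> real) \<Rightarrow> 'n heis \<Rightarrow> real" where
  "LH m \<phi> \<xi> = - hdiv (\<lambda>\<eta>. (hnorm \<eta> powr (- 2 * m)) *\<^sub>R hgrad \<phi> \<eta>) \<xi>"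

definition hmu :: "real \<Rightarrow> real \<Rightarrow> real" where
  "hmu Q lam = (Q - 2) / 2 - sqrt (((Q - 2) / 2)\<^sup>2 - lam)"

definition I_right :: "real \<Rightarrow> real \<Rightarrow> (real \<Rightarrow> real) \<Rightarrow> real \<Rightarrow> real" where
  "I_right gam T \<phi> t =
     (if gam = 0 then \<phi> t
      else 1 / Gamma gam * (LINT \<tau>:{t<..<T}|lebesgue. (\<tau> - t) powr (gam - 1) * \<phi> \<tau>))"

definition essentially_bounded :: "('a::euclidean_space \<Rightarrow> real) \<Rightarrow> bool" where
  "essentially_bounded g \<longleftrightarrow>
     g \<in> borel_measurable lebesgue \<and> (\<exists>M. AE \<xi> in lebesgue. \<bar>g \<xi>\<bar> \<le> M)"

text \<open>
  Local \<open>L\<^sup>q\<close> integrability on \<open>S\<close> with respect to the weighted measure \<open>w z dz\<close>. By Tonelli,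
  the space \<open>L\<^sup>q\<^sub>l\<^sub>o\<^sub>c((0,T), L\<^sup>q\<^sub>l\<^sub>o\<^sub>c(w d\<xi>))\<close> is the case \<open>S = {0<..<T} \<times> UNIV\<close>, because every compact
  subset of \<open>S\<close> lies in a product of compact sets.
\<close>

definition locally_Lp ::
    "real \<Rightarrow> ('a::euclidean_space \<Rightarrow> real) \<Rightarrow> 'a set \<Rightarrow> ('a \<Rightarrow> real) \<Rightarrow> bool" where
  "locally_Lp q w S g \<longleftrightarrow>
     set_borel_measurable lebesgue S g \<and>
     (\<forall>K. compact K \<and> K \<subseteq> S \<longrightarrow> set_integrable lebesgue K (\<lambda>z. w z * \<bar>g z\<bar> powr q))"

definition C2 :: "('a::euclidean_space \<Rightarrow> real) \<Rightarrow> bool" where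
  "C2 g \<longleftrightarrow> g differentiable_on UNIV \<and>
     (\<forall>b\<in>Basis. pd b g differentiable_on UNIV \<and>
        (\<forall>c\<in>Basis. continuous_on UNIV (pd c (pd b g))))"

definition C2_ops :: "(('a::euclidean_space \<Rightarrow> real) \<Rightarrow> 'a \<Rightarrow> real) set" where
  "C2_ops = {\<lambda>g. g} \<union> {pd b |b. b \<in> Basis} \<union>
     {\<lambda>g. pd c (pd b g) |b c. b \<in> Basis \<and> c \<in> Basis}"

text \<open>
  The class \<open>C\<^sub>c\<^sup>1([0,T), C\<^sub>c\<^sup>2)\<close> of maps \<open>t \<mapsto> \<phi> t\<close>, with derivative \<open>\<phi>'\<close>. Convergence in
  \<open>C\<^sub>c\<^sup>2\<close> is uniform convergence of all partial derivatives up to order two with supports in a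
  fixed compact set; such a set \<open>K\<close> exists uniformly in \<open>t\<close> because \<open>\<phi>\<close> has compact support in \<open>t\<close>.
  The values of \<open>\<phi>\<close> outside \<open>[0,T)\<close> are irrelevant.
\<close>

definition test_fun :: "real \<Rightarrow> (real \<Rightarrow> 'a::euclidean_space \<Rightarrow> real) \<Rightarrow> bool" where
  "test_fun T \<phi> \<longleftrightarrow> (\<exists>K T' \<phi>'. compact K \<and> T' < T \<and>
     (\<forall>t\<in>{0..<T}. C2 (\<phi> t) \<and> C2 (\<phi>' t) \<and>
        (\<forall>\<xi>. \<xi> \<notin> K \<or> T' < t \<longrightarrow> \<phi> t \<xi> = 0) \<and>
        (\<forall>D\<in>C2_ops.
           uniform_limit UNIV (\<lambda>s \<xi>. (D (\<phi> s) \<xi> - D (\<phi> t) \<xi>) / (s - t)) (D (\<phi>' t))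
             (at t within {0..<T}) \<and>
           uniform_limit UNIV (\<lambda>s. D (\<phi>' s)) (D (\<phi>' t)) (at t within {0..<T}))))"

text \<open>
  Weak solutions \<open>u\<close> on \<open>(0,T)\<close>, expressed through \<open>v = \<parallel>\<xi>\<parallel>\<^sup>m u\<close> with \<open>m = hmu Q lam\<close>. The inverse-square
  potential does not appear explicitly: \<open>\<parallel>\<xi>\<parallel>\<^sup>-\<^sup>m\<close> is annihilated by \<open>- \<Delta>\<^sub>H\<close> minus the
  potential, and multiplying the equation by it turns that operator on \<open>u\<close> into \<open>LH m\<close> on \<open>v\<close>. The space-time integrals are Lebesgue
  integrals over \<open>(0,T) \<times> \<real>\<^sup>2\<^sup>N\<^sup>+\<^sup>1\<close>. Since a Bochner integral is \<open>0\<close> when it does not exist, the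
  existence of every integral in the identity is part of the definition.
\<close>

definition weak_solution ::
    "real \<Rightarrow> real \<Rightarrow> real \<Rightarrow> real \<Rightarrow> ('n::finite heis \<Rightarrow> real) \<Rightarrow> ('n heis \<Rightarrow> real) \<Rightarrow>
     real \<Rightarrow> (real \<Rightarrow> 'n heis \<Rightarrow> real) \<Rightarrow> bool" where
  "weak_solution lam gam alpha p u0 f T u \<longleftrightarrow>
    (let m = hmu (hdim TYPE('n)) lam;
         v = (\<lambda>(t, \<xi>). hnorm \<xi> powr m * u t \<xi>);
         v0 = (\<lambda>\<xi>. hnorm \<xi> powr m * u0 \<xi>);
         S = {0<..<T} \<times> (UNIV :: 'n heis set)
     in
       locally_Lp 1 (\<lambda>\<xi>. hnorm \<xi> powr (- 2 * m)) UNIV v0 \<and>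
       locally_Lp 1 (\<lambda>\<xi>. hnorm \<xi> powr (- m)) UNIV f \<and>
       locally_Lp p (\<lambda>(t, \<xi>). hnorm \<xi> powr (- (p + 1) * m)) S v \<and>
       locally_Lp 1 (\<lambda>(t, \<xi>). hnorm \<xi> powr (- 2 * m)) S v \<and>
       (\<forall>\<phi>. test_fun T \<phi> \<and> (\<forall>t\<in>{0..<T}. \<forall>\<xi>. 0 \<le> \<phi> t \<xi>) \<longrightarrow>
         (let A = (\<lambda>(t, \<xi>). v (t, \<xi>) *
                (hnorm \<xi> powr (- 2 * m) * deriv (\<lambda>s. \<phi> s \<xi>) t - LH m (\<phi> t) \<xi>));
              B = (\<lambda>(t, \<xi>). hnorm \<xi> powr (- (p + 1) * m) * \<bar>v (t, \<xi>)\<bar> powr p *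
                I_right gam T (\<lambda>s. \<phi> s \<xi>) t);
              D = (\<lambda>\<xi>. hnorm \<xi> powr (- 2 * m) * v0 \<xi> * \<phi> 0 \<xi>);
              E = (\<lambda>(t, \<xi>). hnorm \<xi> powr (- m) * t powr alpha * f \<xi> * \<phi> t \<xi>)
          in
            set_integrable lebesgue S A \<and> set_integrable lebesgue S B \<and>
            integrable lebesgue D \<and> set_integrable lebesgue S E \<and>
            - (LINT z:S|lebesgue. A z) =
              (LINT z:S|lebesgue. B z) + (LINT \<xi>|lebesgue. D \<xi>) + (LINT z:S|lebesgue. E z))))"

definition max_existence_time ::
    "real \<Rightarrow> real \<Rightarrow> real \<Rightarrow> real \<Rightarrow> ('n::finite heis \<Rightarrow> real) \<Rightarrow> ('n heis \<Rightarrow> real) \<Rightarrow> ereal" where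
  "max_existence_time lam gam alpha p u0 f =
     Sup (ereal ` {T. 0 < T \<and> (\<exists>u. weak_solution lam gam alpha p u0 f T u)})"

end

theory Submission
  imports Defs
begin

text \<open>
  The lifespan bound comes from testing the equation with a single rescaled function. Fix a scale
  \<open>a \<ge> 1\<close> below the existence time \<open>T\<close> and test with
  \<open>\<phi>(t, \<xi>) = (1 - t/a)\<^sub>+\<^sup>n g(\<xi>)\<^sub>+\<^sup>n\<close>, where
  \<open>g(x, y, w) = 1 - (|x|\<^sup>2 + |y|\<^sup>2)/a - (w/a - 3)\<^sup>2\<close>. The set \<open>{g > 0}\<close> is the image, under the
  Heisenberg dilation by \<open>\<surd>a\<close>, of the Euclidean unit ball around \<open>(0, 0, 3)\<close>. On it the Koranyi
  norm is comparable to \<open>\<surd>a\<close>; in particular it is at least \<open>1\<close>, so that the lower bound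
  \<open>f \<ge> \<epsilon> \<parallel>\<xi>\<parallel>\<^sup>-\<^sup>2\<^sup>\<beta>\<close> holds on the whole support of \<open>\<phi>\<close>, and the weights, singular only at the
  origin, are smooth there.

  The time derivative of \<open>\<phi>\<close> and the operator \<open>L\<^sub>H\<close> both cost a factor \<open>1/a\<close>
  (\<open>DERIV_time_cutoff\<close>, \<open>LH_bump_bound\<close>), while the memory operator applied to \<open>\<phi>\<close> is at least
  of order \<open>a\<^sup>\<gamma>\<close> (\<open>I_right_time_cutoff_lower\<close>). Hence Young's inequality absorbs the linear terms
  of the weak formulation into the term with \<open>|v|\<^sup>p\<close>, at the price of
  \<open>C \<parallel>\<xi>\<parallel>\<^sup>-\<^sup>m a\<^sup>-\<^sup>\<theta>\<close> with \<open>\<theta> = (p + \<gamma>)/(p - 1)\<close>, carried by the support of \<open>\<phi>\<close>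
  (\<open>test_integrand_absorbed\<close>). A large exponent \<open>n\<close> keeps this price bounded up to the
  boundary of the support. The term with the initial datum is nonnegative, and the forcing term
  is at least \<open>c \<epsilon> \<parallel>\<xi>\<parallel>\<^sup>-\<^sup>m a\<^sup>\<alpha>\<^sup>-\<^sup>\<beta>\<close> on a fixed proportion of that support
  (\<open>forcing_lower_bound\<close>). Both regions have volume of order \<open>a\<^sup>1\<^sup>+\<^sup>Q\<^sup>/\<^sup>2\<close>, so volumes and the common
  weight cancel and \<open>\<epsilon> a\<^sup>\<alpha>\<^sup>-\<^sup>\<beta> \<le> C a\<^sup>-\<^sup>\<theta>\<close> remains (\<open>forcing_size_bound\<close>). Since
  \<open>\<theta> + \<alpha> - \<beta> > 0\<close>, this bounds \<open>a\<close>, hence \<open>T\<close>, by the claimed power of \<open>\<epsilon>\<close>. Existence times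
  \<open>T \<le> 1\<close>, for which no admissible scale exists, satisfy the bound because \<open>\<epsilon> \<le> \<epsilon>\<^sub>0\<close>.
\<close>

section \<open>Truncated powers and the absorption inequality\<close>

text \<open>
  A function \<open>g\<^sub>+\<^sup>n\<close> vanishes where \<open>g\<close> is negative, and differentiating it lowers the exponent by
  one. The ratios of cutoffs and derivatives that Young's inequality produces are therefore again
  powers of \<open>g\<^sub>+\<close>, with nonnegative exponents once \<open>n\<close> is large.
\<close>

definition tpow :: "nat \<Rightarrow> real \<Rightarrow> real" where
  "tpow n x = max 0 x ^ n"

lemma tpow_nonneg [simp]: "0 \<le> tpow n x"
  by (simp add: tpow_def)

lemma tpow_eq_power: "0 \<le> x \<Longrightarrow> tpow n x = x ^ n"
  by (simp add: tpow_def)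

lemma tpow_eq_0: "x \<le> 0 \<Longrightarrow> 0 < n \<Longrightarrow> tpow n x = 0"
  by (simp add: tpow_def max_def)

lemma tpow_antimono: "x \<le> 1 \<Longrightarrow> i \<le> j \<Longrightarrow> tpow j x \<le> tpow i x"
  unfolding tpow_def by (intro power_decreasing) auto

lemma continuous_on_tpow: "continuous_on A (tpow n)"
  unfolding tpow_def by (intro continuous_intros)

lemma DERIV_tpow:
  "(tpow (Suc (Suc n)) has_real_derivative real (Suc (Suc n)) * tpow (Suc n) x) (at x)"
proof -
  consider "0 < x" | "x < 0" | "x = 0" by linarith
  then show ?thesis
  proof cases
    case 1
    have "((\<lambda>y. y ^ Suc (Suc n)) has_real_derivative real (Suc (Suc n)) * x ^ Suc n) (at x)"
      by (rule derivative_eq_intros refl | simp)+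
    then show ?thesis
      using 1 by (subst tpow_eq_power) (auto intro: has_field_derivative_transform_within_open[of _ _ x "{0<..}"]
          simp: tpow_eq_power simp del: power_Suc)
  next
    case 2
    have "((\<lambda>y. 0) has_real_derivative 0) (at x)"
      by simp
    then have "(tpow (Suc (Suc n)) has_real_derivative 0) (at x)"
      by (rule has_field_derivative_transform_within_open[of _ _ x "{..<0}"])
         (use 2 in \<open>auto simp: tpow_eq_0\<close>)
    then show ?thesis
      using 2 by (simp add: tpow_eq_0)
  next
    case 3
    have "((\<lambda>h. tpow (Suc n) h) \<longlongrightarrow> tpow (Suc n) 0) (at 0)"
      using continuous_on_tpow[of UNIV] by (auto simp: continuous_on_def)
    then have lim: "((\<lambda>h. tpow (Suc n) h) \<longlongrightarrow> 0) (at 0)"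
      by (simp add: tpow_eq_0)
    have "((\<lambda>h. tpow (Suc (Suc n)) h / h) \<longlongrightarrow> 0) (at 0)"
      by (rule Lim_null_comparison[OF always_eventually lim])
         (auto simp: tpow_def max_def)
    then show ?thesis
      using 3 by (simp add: has_field_derivative_iff tpow_eq_0)
  qed
qed

text \<open>
  Young's inequality without its optimal constant: the two sides of \<open>q x \<le> b x\<^sup>p\<close> cross at
  \<open>x = (q/b)\<^bsup>1/(p-1)\<^esup>\<close>. Beyond that point the power wins, and before it \<open>q x\<close> is at most its value there.
\<close>

lemma linear_absorbed_by_power:
  fixes x p q b :: real
  assumes "1 < p" "0 \<le> x" "0 < b" "0 \<le> q"
  shows "q * x \<le> b * x powr p + q * (q / b) powr (1 / (p - 1))"
proof (cases "x \<le> (q / b) powr (1 / (p - 1))")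
  case True
  then show ?thesis
    using assms by (auto intro!: add_increasing mult_left_mono)
next
  case False
  then have "((q / b) powr (1 / (p - 1))) powr (p - 1) \<le> x powr (p - 1)"
    using assms by (intro powr_mono2) auto
  then have "q / b \<le> x powr (p - 1)"
    using assms by (simp add: powr_powr)
  then have "q * x \<le> b * x powr (p - 1) * x"
    using assms by (intro mult_right_mono) (auto simp: field_simps)
  also have "\<dots> = b * x powr p"
    using False assms powr_ge_zero[of "q/b" "1 / (p - 1)"]
    by (auto simp: powr_diff abs_of_pos simp del: powr_ge_zero)
  finally show ?thesis
    using assms by (simp add: add_increasing2)
qed

text \<open>
  The bookkeeping of exponents when the linear terms are absorbed. Here \<open>h\<close> is the Koranyi norm,
  \<open>z\<close> and \<open>G\<close> are the arguments of the time and space cutoffs, and \<open>x = |v|\<close>. In the remainder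
  \<open>q (q/b)\<^bsup>1/(p-1)\<^esup>\<close> the power of \<open>h\<close> collapses to \<open>- m\<close>; the powers of \<open>z\<close> and \<open>G\<close> are at most \<open>1\<close> because
  \<open>n\<close> is large, and can be dropped.
\<close>

lemma test_integrand_young:
  fixes h a z G C c p m gam x :: real and n :: nat
  assumes pos: "0 < h" "0 < a" "0 < z" "0 < G" "z \<le> 1" "G \<le> 1" "0 < C" "0 < c" "1 < p" "0 \<le> x"
    and gam: "gam < 1" and n: "3 + 2 / (p - 1) \<le> real n"
  shows "C / a * h powr (- 2 * m) * z ^ (n - 1) * G ^ (n - 2) * x
     \<le> c * h powr (- (p + 1) * m) * a powr gam * z powr (n + gam) * G ^ n * x powr p
       + C * (C / c) powr (1 / (p - 1)) * a powr (- ((p + gam) / (p - 1))) * h powr (- m)"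
proof -
  define e where "e = 1 / (p - 1)"
  have e: "0 < e" "e * (p - 1) = 1" using pos by (auto simp: e_def)
  have n2: "3 + 2 * e \<le> real n" using n by (simp add: e_def)
  then have n3: "n \<ge> 2" using e by linarith
  \<comment> \<open>Natural-number powers are rewritten as real powers, so that exponents can be added up.\<close>
  define q where "q = C * a powr (-1) * h powr (- 2 * m) * z powr (real n - 1) * G powr (real n - 2)"
  define b where "b = c * h powr (- (p + 1) * m) * a powr gam * z powr (n + gam) * G powr n"
  have q: "q = C / a * h powr (- 2 * m) * z ^ (n - 1) * G ^ (n - 2)"
    using pos n3 by (simp add: q_def powr_minus divide_simps powr_realpow[symmetric] of_nat_diff)
  have b: "b = c * h powr (- (p + 1) * m) * a powr gam * z powr (n + gam) * G ^ n"
    using pos by (simp add: b_def powr_realpow)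
  have "q / b = (C / c) * (a powr (-1 - gam) * h powr (m * (p - 1)) * z powr (-1 - gam) * G powr (-2))"
  proof -
    have "q / b = (C / c) * ((a powr (-1) / a powr gam) * (h powr (- 2 * m) / h powr (- (p + 1) * m))
        * (z powr (real n - 1) / z powr (n + gam)) * (G powr (real n - 2) / G powr n))"
      by (simp add: q_def b_def mult_ac)
    also have "\<dots> = (C / c) * (a powr (-1 - gam) * h powr (- 2 * m - - (p + 1) * m)
        * z powr (real n - 1 - (n + gam)) * G powr (real n - 2 - n))"
      by (simp only: powr_diff)
    also have "- 2 * m - - (p + 1) * m = m * (p - 1)" by algebra
    finally show ?thesis by simp
  qed
  then have "q * (q / b) powr e = q * ((C / c) powr e *
      (a powr ((-1 - gam) * e) * h powr (m * (p - 1) * e) * z powr ((-1 - gam) * e) * G powr (-2 * e)))"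
    using pos by (simp only: powr_mult powr_powr)
  also have "\<dots> = C * (C / c) powr e *
      (a powr (-1 + (-1 - gam) * e) * h powr (- 2 * m + m * (p - 1) * e)
        * z powr (real n - 1 + (-1 - gam) * e) * G powr (real n - 2 + -2 * e))"
    unfolding q_def powr_add by simp
  also have "\<dots> \<le> C * (C / c) powr e * (a powr (-1 + (-1 - gam) * e) * h powr (- 2 * m + m * (p - 1) * e) * 1 * 1)"
  proof (intro mult_left_mono mult_mono)
    have "gam * e \<le> 1 * e" using gam e by (intro mult_right_mono) auto
    then have "0 \<le> real n - 1 + (-1 - gam) * e" using n2 by (simp add: algebra_simps)
    then have "z powr (real n - 1 + (-1 - gam) * e) \<le> 1 powr (real n - 1 + (-1 - gam) * e)"
      using pos by (intro powr_mono2) auto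
    then show "z powr (real n - 1 + (-1 - gam) * e) \<le> 1" by simp
    have "G powr (real n - 2 + -2 * e) \<le> 1 powr (real n - 2 + -2 * e)"
      using pos n2 by (intro powr_mono2) auto
    then show "G powr (real n - 2 + -2 * e) \<le> 1" by simp
  qed (use pos in auto)
  also have "-1 + (-1 - gam) * e = - ((p + gam) / (p - 1))"
    using pos by (simp add: e_def field_simps)
  also have "- 2 * m + m * (p - 1) * e = - m"
    using e by (simp add: mult.assoc) (simp add: mult.commute)
  finally have "q * (q / b) powr e \<le> C * (C / c) powr e * (a powr (- ((p + gam) / (p - 1))) * h powr (- m))"
    by simp
  moreover have "q * x \<le> b * x powr p + q * (q / b) powr e"
    unfolding e_def using pos by (intro linear_absorbed_by_power) (auto simp: q_def b_def)
  ultimately show ?thesis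
    unfolding q[symmetric] b[symmetric] e_def by (simp add: mult.assoc)
qed

section \<open>A bump adapted to the Heisenberg dilations\<close>

text \<open>
  The unit paraboloid centred at \<open>(0, 0, 3)\<close>, composed with the inverse of the dilation
  \<open>(x, y, w) \<mapsto> (\<surd>a x, \<surd>a y, a w)\<close>. The centre lies on the vertical axis far enough out for the
  set where the paraboloid is positive to avoid the unit Koranyi ball for all \<open>a \<ge> 1\<close>.
\<close>

definition dilated_paraboloid :: "real \<Rightarrow> 'n::finite heis \<Rightarrow> real" where
  "dilated_paraboloid a \<xi> = 1 - (fst \<xi> \<bullet> fst \<xi> + fst (snd \<xi>) \<bullet> fst (snd \<xi>)) / a - (snd (snd \<xi>) / a - 3)\<^sup>2"

definition dilated_paraboloid_deriv :: "real \<Rightarrow> 'n::finite heis \<Rightarrow> 'n heis \<Rightarrow> real" where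
  "dilated_paraboloid_deriv a \<xi> h = - (2 / a) * (fst \<xi> \<bullet> fst h + fst (snd \<xi>) \<bullet> fst (snd h))
     - 2 / a * (snd (snd \<xi>) / a - 3) * snd (snd h)"

text \<open>
  The fourth power of the Koranyi norm, a polynomial. Writing powers of the norm as powers of it
  makes them differentiable by the chain rule.
\<close>

definition koranyi_quartic :: "'n::finite heis \<Rightarrow> real" where
  "koranyi_quartic \<xi> = (fst \<xi> \<bullet> fst \<xi> + fst (snd \<xi>) \<bullet> fst (snd \<xi>))\<^sup>2 + (snd (snd \<xi>))\<^sup>2"

definition koranyi_quartic_deriv :: "'n::finite heis \<Rightarrow> 'n heis \<Rightarrow> real" where
  "koranyi_quartic_deriv \<xi> h = 4 * (fst \<xi> \<bullet> fst \<xi> + fst (snd \<xi>) \<bullet> fst (snd \<xi>)) * (fst \<xi> \<bullet> fst h + fst (snd \<xi>) \<bullet> fst (snd h))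
     + 2 * snd (snd \<xi>) * snd (snd h)"

lemma hnorm_powr: "hnorm \<xi> powr r = koranyi_quartic \<xi> powr (r / 4)"
proof -
  have P: "koranyi_quartic \<xi> = (\<Sum>i\<in>UNIV. (fst \<xi> $ i)\<^sup>2 + (fst (snd \<xi>) $ i)\<^sup>2)\<^sup>2 + (snd (snd \<xi>))\<^sup>2"
    by (simp add: koranyi_quartic_def inner_vec_def sum.distrib power2_eq_square)
  have "hnorm \<xi> = root 4 (koranyi_quartic \<xi>)"
    unfolding P by (simp add: hnorm_def split: prod.split)
  moreover have "0 \<le> koranyi_quartic \<xi>"
    by (simp add: koranyi_quartic_def)
  ultimately show ?thesis
    by (cases "koranyi_quartic \<xi> = 0") (simp_all add: root_powr_inverse powr_powr)
qed

lemma hnorm_eq: "hnorm \<xi> = koranyi_quartic \<xi> powr (1 / 4)"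
proof -
  have "0 \<le> hnorm \<xi>"
    by (auto simp: hnorm_def split: prod.split)
  then show ?thesis
    using hnorm_powr[of \<xi> 1] by simp
qed

lemma has_derivative_dilated_paraboloid:
  "(dilated_paraboloid a has_derivative dilated_paraboloid_deriv a \<xi>) (at \<xi>)"
  unfolding dilated_paraboloid_def dilated_paraboloid_deriv_def divide_inverse
  by (auto intro!: derivative_eq_intros simp: algebra_simps inner_commute)

lemma has_derivative_koranyi_quartic:
  "(koranyi_quartic has_derivative koranyi_quartic_deriv \<xi>) (at \<xi>)"
  unfolding koranyi_quartic_def koranyi_quartic_deriv_def
  by (auto intro!: derivative_eq_intros simp: algebra_simps inner_commute)

definition bump :: "real \<Rightarrow> nat \<Rightarrow> 'n::finite heis \<Rightarrow> real" where
  "bump a n \<xi> = tpow n (dilated_paraboloid a \<xi>)"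

lemma has_derivative_bump:
  "(bump a (Suc (Suc n)) has_derivative
     (\<lambda>h. real (Suc (Suc n)) * bump a (Suc n) \<xi> * dilated_paraboloid_deriv a \<xi> h)) (at \<xi>)"
proof -
  have "(bump a (Suc (Suc n)) has_derivative
     (\<lambda>h. dilated_paraboloid_deriv a \<xi> h * (real (Suc (Suc n)) * tpow (Suc n) (dilated_paraboloid a \<xi>)))) (at \<xi>)"
    unfolding bump_def
    using has_derivative_compose[OF has_derivative_dilated_paraboloid DERIV_tpow[unfolded has_field_derivative_def]]
    by (simp add: mult.commute)
  then show ?thesis
    by (simp add: bump_def mult_ac)
qed

lemma continuous_on_bump: "continuous_on A (bump a n)"
proof -
  have "continuous_on UNIV (dilated_paraboloid a)"
    unfolding dilated_paraboloid_def divide_inverse by (intro continuous_intros)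
  then have "continuous_on UNIV (bump a n)"
    unfolding bump_def
    by (intro continuous_on_compose2[OF continuous_on_tpow, of UNIV]) auto
  then show ?thesis
    by (rule continuous_on_subset) simp
qed

lemma pd_eqI: "(g has_derivative D) (at \<xi>) \<Longrightarrow> pd b g \<xi> = D b"
  unfolding pd_def using frechet_derivative_at by metis

lemma pd_bump:
  "pd b (bump a (Suc (Suc n))) =
     (\<lambda>\<xi>. real (Suc (Suc n)) * bump a (Suc n) \<xi> * dilated_paraboloid_deriv a \<xi> b)"
  by (rule ext) (rule pd_eqI[OF has_derivative_bump])

lemma has_derivative_dilated_paraboloid_deriv:
  "((\<lambda>\<xi>. dilated_paraboloid_deriv a \<xi> b) has_derivative
    (\<lambda>h. - (2 / a) * (fst h \<bullet> fst b + fst (snd h) \<bullet> fst (snd b)) - 2 / a\<^sup>2 * snd (snd h) * snd (snd b))) (at \<xi>)"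
  unfolding dilated_paraboloid_deriv_def divide_inverse
  by (auto intro!: derivative_eq_intros simp: algebra_simps power2_eq_square)

lemma C2_bump: "C2 (bump a (Suc (Suc (Suc n))))"
proof -
  let ?n = "Suc (Suc n)"
  have der: "((\<lambda>\<xi>. real (Suc ?n) * bump a ?n \<xi> * dilated_paraboloid_deriv a \<xi> b) has_derivative
     (\<lambda>h. real (Suc ?n) * bump a ?n \<xi> * (- (2 / a) * (fst h \<bullet> fst b + fst (snd h) \<bullet> fst (snd b)) - 2 / a\<^sup>2 * snd (snd h) * snd (snd b))
        + real (Suc ?n) * (real ?n * bump a (Suc n) \<xi> * dilated_paraboloid_deriv a \<xi> h) * dilated_paraboloid_deriv a \<xi> b)) (at \<xi>)"
    for b \<xi> :: "'a heis"
    by (rule has_derivative_mult has_derivative_bump has_derivative_dilated_paraboloid_deriv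
        has_derivative_mult_right)+
  have cont: "continuous_on UNIV (\<lambda>\<xi>. dilated_paraboloid_deriv a \<xi> b)" for b :: "'a heis"
    unfolding dilated_paraboloid_deriv_def divide_inverse by (intro continuous_intros)
  show ?thesis
    unfolding C2_def pd_bump
  proof (intro conjI ballI)
    show "bump a (Suc ?n) differentiable_on UNIV"
      unfolding differentiable_on_def differentiable_def using has_derivative_bump by blast
    fix b :: "'a heis"
    show "(\<lambda>\<xi>. real (Suc ?n) * bump a ?n \<xi> * dilated_paraboloid_deriv a \<xi> b) differentiable_on UNIV"
      unfolding differentiable_on_def differentiable_def using der by blast
    fix c :: "'a heis"
    show "continuous_on UNIV (pd c (\<lambda>\<xi>. real (Suc ?n) * bump a ?n \<xi> * dilated_paraboloid_deriv a \<xi> b))"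
      unfolding pd_eqI[OF der]
      by (intro continuous_intros continuous_on_bump cont)
  qed
qed

text \<open>
  Where the bump is supported, the Koranyi norm is comparable to \<open>\<surd>a\<close>. The lower bound comes from the
  vertical coordinate alone.
\<close>

lemma paraboloid_region:
  assumes "0 < a" "0 \<le> dilated_paraboloid a \<xi>"
  shows "fst \<xi> \<bullet> fst \<xi> + fst (snd \<xi>) \<bullet> fst (snd \<xi>) \<le> a" (is "?A \<le> a")
    and "\<bar>snd (snd \<xi>) / a - 3\<bar> \<le> 1"
    and "2 * a \<le> snd (snd \<xi>)" and "snd (snd \<xi>) \<le> 4 * a"
    and "4 * a\<^sup>2 \<le> koranyi_quartic \<xi>" and "koranyi_quartic \<xi> \<le> 17 * a\<^sup>2"
    and "dilated_paraboloid a \<xi> \<le> 1"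
proof -
  have A: "0 \<le> ?A" by simp
  then have Aa: "0 \<le> ?A / a" using assms by simp
  have eq: "dilated_paraboloid a \<xi> = 1 - ?A / a - (snd (snd \<xi>) / a - 3)\<^sup>2"
    by (simp add: dilated_paraboloid_def)
  show "dilated_paraboloid a \<xi> \<le> 1"
    using Aa zero_le_power2[of "snd (snd \<xi>) / a - 3"] unfolding eq by linarith
  have "?A / a \<le> 1"
    using assms zero_le_power2[of "snd (snd \<xi>) / a - 3"] unfolding eq by linarith
  then show le: "?A \<le> a"
    using assms by simp
  have "(snd (snd \<xi>) / a - 3)\<^sup>2 \<le> 1"
    using assms Aa unfolding eq by linarith
  then show w: "\<bar>snd (snd \<xi>) / a - 3\<bar> \<le> 1"
    by (simp add: abs_square_le_1)
  then have "2 \<le> snd (snd \<xi>) / a" "snd (snd \<xi>) / a \<le> 4"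
    by linarith+
  then show w2: "2 * a \<le> snd (snd \<xi>)" and w4: "snd (snd \<xi>) \<le> 4 * a"
    using assms by (simp_all add: field_simps)
  have "(2 * a)\<^sup>2 \<le> (snd (snd \<xi>))\<^sup>2" "(snd (snd \<xi>))\<^sup>2 \<le> (4 * a)\<^sup>2"
    using w2 w4 assms by (intro power_mono; simp)+
  moreover have "?A\<^sup>2 \<le> a\<^sup>2"
    using A le by (intro power_mono) auto
  ultimately show "4 * a\<^sup>2 \<le> koranyi_quartic \<xi>" "koranyi_quartic \<xi> \<le> 17 * a\<^sup>2"
    by (auto simp: koranyi_quartic_def power_mult_distrib intro: add_increasing)
qed

section \<open>The weighted operator on the bump\<close>

text \<open>
  At a point of differentiability the left-invariant fields are derivatives along a horizontal
  vector, which makes the product and chain rules available for them.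
\<close>

lemma hX_eqI:
  fixes u :: "'b::finite heis \<Rightarrow> real"
  assumes "(u has_derivative D) (at \<xi>)"
  shows "hX i u \<xi> = D (axis i 1, 0, 2 * fst (snd \<xi>) $ i)"
proof -
  interpret D: bounded_linear D
    using assms by (rule has_derivative_bounded_linear)
  have "(axis i 1, 0, 2 * fst (snd \<xi>) $ i :: real) = (axis i (1::real), 0 :: real ^ 'b, 0) + (2 * fst (snd \<xi>) $ i) *\<^sub>R (0, 0, 1 :: real)"
    by simp
  then have "D (axis i 1, 0, 2 * fst (snd \<xi>) $ i) = D (axis i 1, 0, 0) + (2 * fst (snd \<xi>) $ i) * D (0, 0, 1 :: real)"
    by (simp only: D.add D.scaleR) simp
  then show ?thesis
    by (simp add: hX_def pd_eqI[OF assms] split: prod.split)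
qed

lemma hY_eqI:
  fixes u :: "'b::finite heis \<Rightarrow> real"
  assumes "(u has_derivative D) (at \<xi>)"
  shows "hY i u \<xi> = D (0, axis i 1, - 2 * fst \<xi> $ i)"
proof -
  interpret D: bounded_linear D
    using assms by (rule has_derivative_bounded_linear)
  have "(0, axis i 1, - 2 * fst \<xi> $ i) = (0 :: real ^ 'b, axis i (1::real), 0) + (- 2 * fst \<xi> $ i) *\<^sub>R (0, 0, 1 :: real)"
    by simp
  then have "D (0, axis i 1, - 2 * fst \<xi> $ i) = D (0, axis i 1, 0) + (- 2 * fst \<xi> $ i) * D (0, 0, 1 :: real)"
    by (simp only: D.add D.scaleR) simp
  then show ?thesis
    by (simp add: hY_def pd_eqI[OF assms] split: prod.split)
qed

text \<open>
  One summand of the horizontal divergence. The bounds on \<open>q\<close>, \<open>q'\<close> and the two polynomials are the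
  ones dictated by homogeneity under dilation by \<open>s = \<surd>a\<close>: a horizontal derivative lowers the
  degree by one. Each of the three terms of the product rule then gains \<open>s\<^sup>-\<^sup>2\<close>, and
  differentiating the weight costs no more than a constant times \<open>1/s\<close> because \<open>4 s\<^sup>4 \<le> \<parallel>\<xi>\<parallel>\<^sup>4\<close> on the support.
\<close>

lemma weighted_bump_derivative_bound:
  fixes \<xi> Z :: "'n::finite heis" and k :: nat
  defines "n \<equiv> Suc (Suc k)"
  assumes s: "0 < s" and reg: "0 \<le> dilated_paraboloid (s\<^sup>2) \<xi>"
    and q: "(q has_derivative q') (at \<xi>)"
    and bd: "\<bar>q \<xi>\<bar> \<le> 6 / s" "\<bar>q' Z\<bar> \<le> 10 / s\<^sup>2" "\<bar>dilated_paraboloid_deriv (s\<^sup>2) \<xi> Z\<bar> \<le> 6 / s"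
      "\<bar>koranyi_quartic_deriv \<xi> Z\<bar> \<le> 20 * s ^ 3"
  obtains D where "((\<lambda>\<eta>. hnorm \<eta> powr (- 2 * m) * (c * bump (s\<^sup>2) n \<eta> * q \<eta>)) has_derivative D) (at \<xi>)"
    and "\<bar>D Z\<bar> \<le> \<bar>c\<bar> * (15 * \<bar>m\<bar> + 36 * real n + 10) / s\<^sup>2 * hnorm \<xi> powr (- 2 * m) * bump (s\<^sup>2) (Suc k) \<xi>"
proof -
  let ?a = "s\<^sup>2" and ?P = "koranyi_quartic \<xi>" and ?r = "- m / 2"
  let ?W = "?P powr ?r" and ?b = "bump ?a n \<xi>" and ?b' = "bump ?a (Suc k) \<xi>"
  let ?dP = "koranyi_quartic_deriv \<xi>" and ?dg = "dilated_paraboloid_deriv ?a \<xi>"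
  have a: "0 < ?a" using s by simp
  note R = paraboloid_region[OF a reg]
  have P: "0 < ?P"
    using R(5) a by (meson less_le_trans mult_pos_pos zero_less_numeral zero_less_power)
  have W: "((\<lambda>\<eta>. koranyi_quartic \<eta> powr ?r) has_derivative (\<lambda>h. ?dP h * (?r * ?P powr (?r - 1)))) (at \<xi>)"
    using has_derivative_compose[OF has_derivative_koranyi_quartic
        has_real_derivative_powr[OF P, unfolded has_field_derivative_def]]
    by (simp only: mult.commute)
  define D where "D = (\<lambda>h. ?W * (c * ?b * q' h + c * (real n * ?b' * ?dg h) * q \<xi>)
      + ?dP h * (?r * ?P powr (?r - 1)) * (c * ?b * q \<xi>))"
  have "((\<lambda>\<eta>. koranyi_quartic \<eta> powr ?r * (c * bump ?a n \<eta> * q \<eta>)) has_derivative D) (at \<xi>)"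
    unfolding D_def n_def
    by (rule has_derivative_mult W q has_derivative_mult_right has_derivative_bump)+
  then have 1: "((\<lambda>\<eta>. hnorm \<eta> powr (- 2 * m) * (c * bump ?a n \<eta> * q \<eta>)) has_derivative D) (at \<xi>)"
    by (simp add: hnorm_powr)
  have b: "0 \<le> ?b" "?b \<le> ?b'" "0 \<le> ?b'"
    using R(7) by (auto simp: bump_def n_def intro: tpow_antimono)
  have "\<bar>?dP Z * (?r * ?P powr (?r - 1)) * (c * ?b * q \<xi>)\<bar>
      = \<bar>c\<bar> * (\<bar>m\<bar> / 2) * ?W * (\<bar>?dP Z\<bar> / ?P) * ?b * \<bar>q \<xi>\<bar>"
    using b P by (simp add: abs_mult powr_diff)
  also have "\<dots> \<le> \<bar>c\<bar> * (\<bar>m\<bar> / 2) * ?W * (20 * s ^ 3 / (4 * ?a\<^sup>2)) * ?b' * (6 / s)"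
    using b bd R(5) P a s by (intro mult_mono frac_le) auto
  also have "\<dots> = \<bar>c\<bar> * (15 * \<bar>m\<bar>) / ?a * ?W * ?b'"
    using s by (simp add: field_simps power2_eq_square power3_eq_cube)
  finally have T1: "\<bar>?dP Z * (?r * ?P powr (?r - 1)) * (c * ?b * q \<xi>)\<bar> \<le> \<bar>c\<bar> * (15 * \<bar>m\<bar>) / ?a * ?W * ?b'" .
  have "\<bar>?W * (c * ?b * q' Z)\<bar> = \<bar>c\<bar> * ?W * ?b * \<bar>q' Z\<bar>"
    using b by (simp add: abs_mult)
  also have "\<dots> \<le> \<bar>c\<bar> * ?W * ?b' * (10 / ?a)"
    using b bd by (intro mult_mono) auto
  finally have T2: "\<bar>?W * (c * ?b * q' Z)\<bar> \<le> \<bar>c\<bar> * 10 / ?a * ?W * ?b'"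
    by (simp add: mult_ac)
  have "\<bar>?W * (c * (real n * ?b' * ?dg Z) * q \<xi>)\<bar> = \<bar>c\<bar> * ?W * real n * ?b' * \<bar>?dg Z\<bar> * \<bar>q \<xi>\<bar>"
    using b by (simp add: abs_mult)
  also have "\<dots> \<le> \<bar>c\<bar> * ?W * real n * ?b' * (6 / s) * (6 / s)"
    using b bd s by (intro mult_mono) auto
  also have "\<dots> = \<bar>c\<bar> * (36 * real n) / ?a * ?W * ?b'"
    by (simp add: power2_eq_square mult_ac)
  finally have T3: "\<bar>?W * (c * (real n * ?b' * ?dg Z) * q \<xi>)\<bar> \<le> \<bar>c\<bar> * (36 * real n) / ?a * ?W * ?b'" .
  have "\<bar>D Z\<bar> \<le> \<bar>?W * (c * ?b * q' Z)\<bar> + \<bar>?W * (c * (real n * ?b' * ?dg Z) * q \<xi>)\<bar>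
     + \<bar>?dP Z * (?r * ?P powr (?r - 1)) * (c * ?b * q \<xi>)\<bar>"
    unfolding D_def distrib_left by linarith
  also have "\<dots> \<le> \<bar>c\<bar> * (15 * \<bar>m\<bar> + 36 * real n + 10) / ?a * ?W * ?b'"
    using add_mono[OF add_mono[OF T2 T3] T1]
    by (rule order.trans[OF _ eq_refl]) (simp add: algebra_simps add_divide_distrib)
  finally show ?thesis
    using that[OF 1] by (simp add: hnorm_powr)
qed

lemma LH_bump:
  "LH m (\<lambda>\<xi>. c * bump a (Suc (Suc k)) \<xi>) \<xi> = - (\<Sum>i\<in>UNIV.
     hX i (\<lambda>\<eta>. hnorm \<eta> powr (- 2 * m) * (c * real (Suc (Suc k)) * bump a (Suc k) \<eta>
        * dilated_paraboloid_deriv a \<eta> (axis i 1, 0, 2 * fst (snd \<eta>) $ i))) \<xi>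
   + hY i (\<lambda>\<eta>. hnorm \<eta> powr (- 2 * m) * (c * real (Suc (Suc k)) * bump a (Suc k) \<eta>
        * dilated_paraboloid_deriv a \<eta> (0, axis i 1, - 2 * fst \<eta> $ i))) \<xi>)"
proof -
  note der = has_derivative_mult_right[OF has_derivative_bump, of c a k]
  show ?thesis
    unfolding LH_def hdiv_def hgrad_def
    by (simp add: hX_eqI[OF der] hY_eqI[OF der] mult.assoc)
qed

lemma inner_axis_1 [simp]: "x \<bullet> axis i (1::real) = x $ i"
  by (simp add: inner_axis)

text \<open>
  The horizontal derivatives of the paraboloid and of the quartic are explicit polynomials, and on
  the support the coordinates satisfy \<open>|x\<^sub>i|, |y\<^sub>i| \<le> s\<close> and \<open>2 s\<^sup>2 \<le> w \<le> 4 s\<^sup>2\<close>. This yields the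
  constants \<open>6\<close>, \<open>10\<close> and \<open>20\<close> required by \<open>weighted_bump_derivative_bound\<close>.
\<close>

lemma LH_bump_bound_scaled:
  fixes \<xi> :: "'n::finite heis" and k :: nat
  defines "n \<equiv> Suc (Suc (Suc k))"
  assumes s: "0 < s" and reg: "0 \<le> dilated_paraboloid (s\<^sup>2) \<xi>"
  shows "\<bar>LH m (\<lambda>\<xi>. c * bump (s\<^sup>2) n \<xi>) \<xi>\<bar> \<le> \<bar>c\<bar> * 2 * real CARD('n) * real n * (15 * \<bar>m\<bar> + 36 * real n + 10) / s\<^sup>2
      * hnorm \<xi> powr (- 2 * m) * bump (s\<^sup>2) (n - 2) \<xi>"
proof -
  let ?a = "s\<^sup>2"
  define M where "M = \<bar>c\<bar> * real n * (15 * \<bar>m\<bar> + 36 * real (Suc (Suc k)) + 10) / s\<^sup>2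
      * hnorm \<xi> powr (- 2 * m) * bump (s\<^sup>2) (Suc k) \<xi>"
  have a: "0 < ?a" using s by simp
  note R = paraboloid_region[OF a reg]
  obtain x y w where \<xi>: "\<xi> = (x, y, w)" by (cases \<xi>) auto
  have co: "\<bar>x $ i\<bar> \<le> s" "\<bar>y $ i\<bar> \<le> s" for i
  proof -
    have "\<bar>x $ i\<bar> \<le> norm x" "\<bar>y $ i\<bar> \<le> norm y"
      by (simp_all add: component_le_norm_cart)
    moreover have "(norm x)\<^sup>2 + (norm y)\<^sup>2 \<le> s\<^sup>2"
      using R(1) by (simp add: \<xi> dot_square_norm)
    then have "(norm x)\<^sup>2 \<le> s\<^sup>2" "(norm y)\<^sup>2 \<le> s\<^sup>2"
      using zero_le_power2[of "norm x"] zero_le_power2[of "norm y"] by linarith+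
    then have "norm x \<le> s" "norm y \<le> s"
      using s by (auto intro: power2_le_imp_le)
    ultimately show "\<bar>x $ i\<bar> \<le> s" "\<bar>y $ i\<bar> \<le> s" by linarith+
  qed
  have w: "\<bar>w / ?a - 3\<bar> \<le> 1" "\<bar>w\<bar> \<le> 4 * ?a" and A: "\<bar>x \<bullet> x + y \<bullet> y\<bar> \<le> ?a"
    using R(1-4) a unfolding \<xi> by auto
  \<comment> \<open>The pair \<open>(u, v)\<close> stands for \<open>(x\<^sub>i, y\<^sub>i)\<close> when \<open>X\<^sub>i\<close> is applied and for \<open>(y\<^sub>i, - x\<^sub>i)\<close> when \<open>Y\<^sub>i\<close> is.\<close>
  have g1: "\<bar>- (2 / ?a) * u - 2 / ?a * (w / ?a - 3) * (2 * v)\<bar> \<le> 6 / s" if "\<bar>u\<bar> \<le> s" "\<bar>v\<bar> \<le> s" for u v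
  proof -
    have "\<bar>- (2 / ?a) * u - 2 / ?a * (w / ?a - 3) * (2 * v)\<bar> \<le> 2 / ?a * \<bar>u\<bar> + 2 / ?a * \<bar>w / ?a - 3\<bar> * (2 * \<bar>v\<bar>)"
      by (rule order.trans[OF abs_triangle_ineq4]) (use s in \<open>simp only: abs_mult, simp\<close>)
    also have "\<dots> \<le> 2 / ?a * s + 2 / ?a * 1 * (2 * s)"
      using that w s by (intro add_mono mult_mono) auto
    also have "\<dots> = 6 / s"
      using s by (simp add: field_simps power2_eq_square)
    finally show ?thesis .
  qed
  have p1: "\<bar>4 * (x \<bullet> x + y \<bullet> y) * u + 2 * w * (2 * v)\<bar> \<le> 20 * s ^ 3" if "\<bar>u\<bar> \<le> s" "\<bar>v\<bar> \<le> s" for u v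
  proof -
    have "\<bar>4 * (x \<bullet> x + y \<bullet> y) * u + 2 * w * (2 * v)\<bar> \<le> 4 * \<bar>x \<bullet> x + y \<bullet> y\<bar> * \<bar>u\<bar> + 2 * \<bar>w\<bar> * (2 * \<bar>v\<bar>)"
      by (rule order.trans[OF abs_triangle_ineq]) (simp add: abs_mult)
    also have "\<dots> \<le> 4 * ?a * s + 2 * (4 * ?a) * (2 * s)"
      using that w A s by (intro add_mono mult_mono) auto
    also have "\<dots> = 20 * s ^ 3"
      by (simp add: power2_eq_square power3_eq_cube)
    finally show ?thesis .
  qed
  have q1: "\<bar>- (2 / ?a) - 8 * u\<^sup>2 / ?a\<^sup>2\<bar> \<le> 10 / ?a" if "\<bar>u\<bar> \<le> s" for u
  proof -
    have "u\<^sup>2 \<le> ?a" using that s abs_le_square_iff[of u s] by simp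
    then have "8 * u\<^sup>2 / ?a\<^sup>2 \<le> 8 * ?a / ?a\<^sup>2" by (intro divide_right_mono) auto
    also have "\<dots> = 8 / ?a" using s by (simp add: power2_eq_square)
    finally have "2 / ?a + 8 * u\<^sup>2 / ?a\<^sup>2 \<le> 10 / ?a" by (simp add: field_simps)
    moreover have "0 \<le> 2 / ?a + 8 * u\<^sup>2 / ?a\<^sup>2" by simp
    ultimately show ?thesis by linarith
  qed
  have X: "\<bar>hX i (\<lambda>\<eta>. hnorm \<eta> powr (- 2 * m) * (c * real n * bump ?a (Suc (Suc k)) \<eta>
        * dilated_paraboloid_deriv ?a \<eta> (axis i 1, 0, 2 * fst (snd \<eta>) $ i))) \<xi>\<bar> \<le> M" for i
  proof -
    let ?Z = "(axis i 1, 0, 2 * fst (snd \<xi>) $ i) :: 'n heis"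
    have q: "((\<lambda>\<eta>. dilated_paraboloid_deriv ?a \<eta> (axis i 1, 0, 2 * fst (snd \<eta>) $ i)) has_derivative
      (\<lambda>h. - (2 / ?a) * fst h $ i - 4 / ?a\<^sup>2 * snd (snd h) * fst (snd \<xi>) $ i
            - 4 / ?a * (snd (snd \<xi>) / ?a - 3) * fst (snd h) $ i)) (at \<xi>)"
      unfolding dilated_paraboloid_deriv_def divide_inverse
      by (auto intro!: derivative_eq_intros bounded_linear.has_derivative[OF bounded_linear_vec_nth]
          simp: algebra_simps power2_eq_square)
    have B1: "\<bar>dilated_paraboloid_deriv ?a \<xi> (axis i 1, 0, 2 * fst (snd \<xi>) $ i)\<bar> \<le> 6 / s"
      using g1[of "x $ i" "y $ i"] co by (simp add: dilated_paraboloid_deriv_def \<xi>)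
    have B2: "\<bar>koranyi_quartic_deriv \<xi> ?Z\<bar> \<le> 20 * s ^ 3"
      using p1[of "x $ i" "y $ i"] co by (simp add: koranyi_quartic_deriv_def \<xi>)
    have B3: "\<bar>- (2 / ?a) * fst ?Z $ i - 4 / ?a\<^sup>2 * snd (snd ?Z) * fst (snd \<xi>) $ i
            - 4 / ?a * (snd (snd \<xi>) / ?a - 3) * fst (snd ?Z) $ i\<bar> \<le> 10 / ?a"
      using q1[of "y $ i"] co by (simp add: \<xi> power2_eq_square axis_def mult_ac)
    obtain D where D: "((\<lambda>\<eta>. hnorm \<eta> powr (- 2 * m) * (c * real n * bump ?a (Suc (Suc k)) \<eta>
        * dilated_paraboloid_deriv ?a \<eta> (axis i 1, 0, 2 * fst (snd \<eta>) $ i))) has_derivative D) (at \<xi>)"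
      and le: "\<bar>D ?Z\<bar> \<le> \<bar>c * real n\<bar> * (15 * \<bar>m\<bar> + 36 * real (Suc (Suc k)) + 10) / ?a * hnorm \<xi> powr (- 2 * m) * bump ?a (Suc k) \<xi>"
      by (rule weighted_bump_derivative_bound[OF s reg q B1 B3 B1 B2, where c = "c * real n"])
    show ?thesis
      using le unfolding hX_eqI[OF D] M_def by (simp add: abs_mult)
  qed
  have Y: "\<bar>hY i (\<lambda>\<eta>. hnorm \<eta> powr (- 2 * m) * (c * real n * bump ?a (Suc (Suc k)) \<eta>
        * dilated_paraboloid_deriv ?a \<eta> (0, axis i 1, - 2 * fst \<eta> $ i))) \<xi>\<bar> \<le> M" for i
  proof -
    let ?Z = "(0, axis i 1, - 2 * fst \<xi> $ i) :: 'n heis"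
    have q: "((\<lambda>\<eta>. dilated_paraboloid_deriv ?a \<eta> (0, axis i 1, - 2 * fst \<eta> $ i)) has_derivative
      (\<lambda>h. - (2 / ?a) * fst (snd h) $ i + 4 / ?a\<^sup>2 * snd (snd h) * fst \<xi> $ i
            + 4 / ?a * (snd (snd \<xi>) / ?a - 3) * fst h $ i)) (at \<xi>)"
      unfolding dilated_paraboloid_deriv_def divide_inverse
      by (auto intro!: derivative_eq_intros bounded_linear.has_derivative[OF bounded_linear_vec_nth]
          simp: algebra_simps power2_eq_square)
    have B1: "\<bar>dilated_paraboloid_deriv ?a \<xi> (0, axis i 1, - 2 * fst \<xi> $ i)\<bar> \<le> 6 / s"
      using g1[of "y $ i" "- x $ i"] co by (simp add: dilated_paraboloid_deriv_def \<xi>)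
    have B2: "\<bar>koranyi_quartic_deriv \<xi> ?Z\<bar> \<le> 20 * s ^ 3"
      using p1[of "y $ i" "- x $ i"] co by (simp add: koranyi_quartic_deriv_def \<xi>)
    have B3: "\<bar>- (2 / ?a) * fst (snd ?Z) $ i + 4 / ?a\<^sup>2 * snd (snd ?Z) * fst \<xi> $ i
            + 4 / ?a * (snd (snd \<xi>) / ?a - 3) * fst ?Z $ i\<bar> \<le> 10 / ?a"
      using q1[of "x $ i"] co by (simp add: \<xi> power2_eq_square axis_def mult_ac)
    obtain D where D: "((\<lambda>\<eta>. hnorm \<eta> powr (- 2 * m) * (c * real n * bump ?a (Suc (Suc k)) \<eta>
        * dilated_paraboloid_deriv ?a \<eta> (0, axis i 1, - 2 * fst \<eta> $ i))) has_derivative D) (at \<xi>)"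
      and le: "\<bar>D ?Z\<bar> \<le> \<bar>c * real n\<bar> * (15 * \<bar>m\<bar> + 36 * real (Suc (Suc k)) + 10) / ?a * hnorm \<xi> powr (- 2 * m) * bump ?a (Suc k) \<xi>"
      by (rule weighted_bump_derivative_bound[OF s reg q B1 B3 B1 B2, where c = "c * real n"])
    show ?thesis
      using le unfolding hY_eqI[OF D] M_def by (simp add: abs_mult)
  qed
  have "\<bar>LH m (\<lambda>\<xi>. c * bump ?a n \<xi>) \<xi>\<bar> \<le> (\<Sum>i\<in>(UNIV :: 'n set). M + M)"
    unfolding n_def LH_bump abs_minus_cancel
    by (rule order.trans[OF sum_abs sum_mono], rule order.trans[OF abs_triangle_ineq add_mono])
       (use X Y in \<open>auto simp: n_def\<close>)
  also have "\<dots> = 2 * real CARD('n) * M" by simp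
  also have "\<dots> \<le> 2 * real CARD('n) * (\<bar>c\<bar> * real n * (15 * \<bar>m\<bar> + 36 * real n + 10) / s\<^sup>2
      * hnorm \<xi> powr (- 2 * m) * bump (s\<^sup>2) (n - 2) \<xi>)"
    unfolding M_def n_def
    by (intro mult_left_mono mult_mono divide_right_mono) (auto simp: bump_def)
  finally show ?thesis
    by (simp only: mult_ac times_divide_eq_right times_divide_eq_left)
qed

text \<open>
  Where the paraboloid is negative, the bump vanishes on a neighbourhood. This covers
  the origin, where differentiability of the weight may fail.
\<close>

lemma LH_bump_bound:
  fixes \<xi> :: "'n::finite heis" and k :: nat
  defines "n \<equiv> Suc (Suc (Suc k))"
  assumes a: "0 < a"
  shows "\<bar>LH m (\<lambda>\<xi>. c * bump a n \<xi>) \<xi>\<bar> \<le> \<bar>c\<bar> * 2 * real CARD('n) * real n * (15 * \<bar>m\<bar> + 36 * real n + 10) / a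
      * hnorm \<xi> powr (- 2 * m) * bump a (n - 2) \<xi>"
proof (cases "0 \<le> dilated_paraboloid a \<xi>")
  case True
  then show ?thesis
    using LH_bump_bound_scaled[of "sqrt a" \<xi> m c k] a by (simp add: n_def)
next
  case False
  define U where "U = {\<eta> :: 'n heis. 0 \<le> dilated_paraboloid a \<eta>}"
  have "continuous_on UNIV (dilated_paraboloid a :: 'n heis \<Rightarrow> real)"
    unfolding dilated_paraboloid_def divide_inverse by (intro continuous_intros)
  then have U: "closed U" "\<xi> \<notin> U"
    using False unfolding U_def by (auto intro!: closed_Collect_le continuous_on_const)
  have z: "bump a (Suc (Suc k)) \<eta> = 0" if "\<eta> \<notin> U" for \<eta>
    using that by (simp add: U_def bump_def tpow_eq_0)
  have 0: "(u has_derivative (\<lambda>h. 0)) (at \<xi>)" if "\<And>\<eta>. \<eta> \<notin> U \<Longrightarrow> u \<eta> = 0" for u :: "'n heis \<Rightarrow> real"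
  proof -
    have "((\<lambda>\<eta>. 0) has_derivative (\<lambda>h. 0)) (at \<xi>)" by simp
    then show ?thesis
      by (rule has_derivative_transform_within_open[of _ _ _ _ "- U"]) (use U that in auto)
  qed
  have "LH m (\<lambda>\<xi>. c * bump a n \<xi>) \<xi> = 0"
    unfolding n_def LH_bump
    by (simp add: hX_eqI[OF 0] hY_eqI[OF 0] z)
  then show ?thesis
    using a by (simp add: bump_def)
qed

section \<open>Products of time and space cutoffs as test functions\<close>

lemma C2_op_scale:
  assumes g: "C2 g" and D: "D \<in> C2_ops"
  shows "D (\<lambda>\<xi>. c * g \<xi>) = (\<lambda>\<xi>. c * D g \<xi>)"
proof -
  have pd_scale: "pd b (\<lambda>\<xi>. c * h \<xi>) = (\<lambda>\<xi>. c * pd b h \<xi>)" if h: "h differentiable_on UNIV" for b and h :: "'a \<Rightarrow> real"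
  proof
    fix \<xi>
    obtain h' where h': "(h has_derivative h') (at \<xi>)"
      using h by (auto simp: differentiable_on_def differentiable_def)
    show "pd b (\<lambda>\<xi>. c * h \<xi>) \<xi> = c * pd b h \<xi>"
      using pd_eqI[OF h'] pd_eqI[OF has_derivative_mult_right[OF h', of c]] by simp
  qed
  show ?thesis
    using g D by (auto simp: C2_ops_def C2_def pd_scale)
qed

lemma C2_scale:
  assumes g: "C2 g"
  shows "C2 (\<lambda>\<xi>. c * g \<xi>)"
proof -
  have sc1: "pd b (\<lambda>\<xi>. c * g \<xi>) = (\<lambda>\<xi>. c * pd b g \<xi>)" if "b \<in> Basis" for b
    by (rule C2_op_scale[OF g, of "pd b"]) (use that in \<open>auto simp: C2_ops_def\<close>)
  have sc2: "pd d (\<lambda>\<xi>. c * pd b g \<xi>) = (\<lambda>\<xi>. c * pd d (pd b g) \<xi>)"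
    if "b \<in> Basis" "d \<in> Basis" for b d
    unfolding sc1[OF that(1), symmetric]
    by (rule C2_op_scale[OF g, of "\<lambda>g. pd d (pd b g)"]) (use that in \<open>auto simp: C2_ops_def\<close>)
  have df: "(\<lambda>\<xi>. c * h \<xi>) differentiable_on UNIV" if "h differentiable_on UNIV" for h :: "'a \<Rightarrow> real"
    using that by (intro differentiable_on_mult differentiable_on_const)
  show ?thesis
    using g unfolding C2_def
    by (auto simp: sc1 sc2 df intro!: continuous_intros)
qed

lemma pd_eq_0_off_support:
  assumes "closed K" "\<And>\<eta>. \<eta> \<notin> K \<Longrightarrow> g \<eta> = 0" "\<xi> \<notin> K"
  shows "pd b g \<xi> = 0"
proof -
  have "((\<lambda>\<eta>. 0) has_derivative (\<lambda>h. 0)) (at \<xi>)"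
    by simp
  then have "(g has_derivative (\<lambda>h. 0)) (at \<xi>)"
    by (rule has_derivative_transform_within_open[of _ _ _ _ "- K"]) (use assms in auto)
  then show ?thesis
    by (rule pd_eqI)
qed

lemma bounded_C2_op:
  assumes g: "C2 g" and K: "compact K" "\<And>\<xi>. \<xi> \<notin> K \<Longrightarrow> g \<xi> = 0" and D: "D \<in> C2_ops"
  obtains M where "0 < M" "\<And>\<xi>. \<bar>D g \<xi>\<bar> \<le> M"
proof -
  have cont: "continuous_on UNIV (D g)"
    using g D by (auto simp: C2_ops_def C2_def intro: differentiable_imp_continuous_on)
  have 0: "pd b g \<xi> = 0" "pd c (pd b g) \<xi> = 0" if "\<xi> \<notin> K" for b c \<xi>
    using pd_eq_0_off_support[OF compact_imp_closed[OF K(1)]] K(2) that by blast+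
  have off: "D g \<xi> = 0" if "\<xi> \<notin> K" for \<xi>
    using D 0 K that by (auto simp: C2_ops_def)
  have "compact (D g ` K)"
    using cont K by (intro compact_continuous_image) (auto intro: continuous_on_subset)
  then obtain M where M: "0 < M" "\<forall>y\<in>D g ` K. norm y \<le> M"
    using compact_imp_bounded bounded_pos by blast
  have "\<bar>D g \<xi>\<bar> \<le> M" for \<xi>
    using M off[of \<xi>] by (cases "\<xi> \<in> K") auto
  then show ?thesis
    using that M by blast
qed

lemma uniform_limit_scale_bounded:
  fixes g :: "'a \<Rightarrow> real"
  assumes lim: "(c \<longlongrightarrow> c0) F" and M: "0 < M" "\<And>\<xi>. \<bar>g \<xi>\<bar> \<le> M"
  shows "uniform_limit UNIV (\<lambda>s \<xi>. c s * g \<xi>) (\<lambda>\<xi>. c0 * g \<xi>) F"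
proof (rule uniform_limitI)
  fix e :: real assume "0 < e"
  then have "\<forall>\<^sub>F s in F. dist (c s) c0 < e / M"
    using M lim by (intro tendstoD) auto
  then show "\<forall>\<^sub>F s in F. \<forall>\<xi>\<in>UNIV. dist (c s * g \<xi>) (c0 * g \<xi>) < e"
  proof (eventually_elim, intro ballI)
    case (elim s)
    fix \<xi>
    have "dist (c s * g \<xi>) (c0 * g \<xi>) = dist (c s) c0 * \<bar>g \<xi>\<bar>"
      by (simp add: dist_real_def left_diff_distrib flip: abs_mult)
    also have "\<dots> \<le> dist (c s) c0 * M"
      using M by (intro mult_left_mono) auto
    also have "\<dots> < e"
      using elim M by (simp add: field_simps)
    finally show "dist (c s * g \<xi>) (c0 * g \<xi>) < e" .
  qed
qed

text \<open>
  For a product, every difference quotient in time factors as a scalar difference quotient times a fixed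
  function of \<open>\<xi>\<close>. That function is bounded, being continuous with compact support, so scalar
  convergence is already uniform convergence.
\<close>

lemma test_fun_product:
  assumes g: "C2 g" and K: "compact K" "\<And>\<xi>. \<xi> \<notin> K \<Longrightarrow> g \<xi> = 0"
    and \<eta>: "\<And>t. (\<eta> has_real_derivative \<eta>' t) (at t)" "continuous_on UNIV \<eta>'"
    and T: "T' < T" "\<And>t. T' < t \<Longrightarrow> \<eta> t = 0"
  shows "test_fun T (\<lambda>t \<xi>. \<eta> t * g \<xi>)"
  unfolding test_fun_def
proof (intro exI[of _ K] exI[of _ T'] exI[of _ "\<lambda>t \<xi>. \<eta>' t * g \<xi>"] conjI ballI)
  fix t D assume t: "t \<in> {0..<T}" and D: "D \<in> (C2_ops :: (('a \<Rightarrow> real) \<Rightarrow> 'a \<Rightarrow> real) set)"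
  note sc = C2_op_scale[OF g D]
  obtain M where M: "0 < M" "\<And>\<xi>. \<bar>D g \<xi>\<bar> \<le> M"
    using bounded_C2_op[OF g K D] by blast
  have "((\<lambda>s. (\<eta> s - \<eta> t) / (s - t)) \<longlongrightarrow> \<eta>' t) (at t within {0..<T})"
    using has_field_derivative_at_within[OF \<eta>(1)] by (simp add: has_field_derivative_iff)
  from uniform_limit_scale_bounded[OF this, of M "D g"] M
  show "uniform_limit UNIV (\<lambda>s \<xi>. (D (\<lambda>\<xi>. \<eta> s * g \<xi>) \<xi> - D (\<lambda>\<xi>. \<eta> t * g \<xi>) \<xi>) / (s - t))
    (D (\<lambda>\<xi>. \<eta>' t * g \<xi>)) (at t within {0..<T})"
    unfolding sc by (simp add: left_diff_distrib[symmetric])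
  have "(\<eta>' \<longlongrightarrow> \<eta>' t) (at t within {0..<T})"
    using \<eta>(2) by (metis UNIV_I continuous_on_def continuous_on_subset subset_UNIV t)
  from uniform_limit_scale_bounded[OF this, of M "D g"] M
  show "uniform_limit UNIV (\<lambda>s. D (\<lambda>\<xi>. \<eta>' s * g \<xi>)) (D (\<lambda>\<xi>. \<eta>' t * g \<xi>)) (at t within {0..<T})"
    unfolding sc by simp
qed (use K T C2_scale[OF g] in auto)

section \<open>The time cutoff and the fractional integral\<close>

definition time_cutoff :: "real \<Rightarrow> nat \<Rightarrow> real \<Rightarrow> real" where
  "time_cutoff a n t = tpow n (1 - t / a)"

lemma DERIV_time_cutoff:
  "(time_cutoff a (Suc (Suc n)) has_real_derivative
     - (real (Suc (Suc n)) / a) * time_cutoff a (Suc n) t) (at t)"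
proof -
  have "((\<lambda>t. 1 - t / a) has_real_derivative - (1 / a)) (at t)"
    unfolding divide_inverse by (auto intro!: derivative_eq_intros)
  from DERIV_chain2[OF DERIV_tpow this] show ?thesis
    unfolding time_cutoff_def by (simp add: mult_ac)
qed

lemma time_cutoff_eq_0: "0 < a \<Longrightarrow> a \<le> t \<Longrightarrow> 0 < n \<Longrightarrow> time_cutoff a n t = 0"
  by (simp add: time_cutoff_def tpow_eq_0)

lemma continuous_on_time_cutoff: "continuous_on A (time_cutoff a n)"
proof -
  have "continuous_on UNIV (time_cutoff a n)"
    unfolding time_cutoff_def divide_inverse
    by (intro continuous_on_compose2[OF continuous_on_tpow, of UNIV] continuous_intros) auto
  then show ?thesis
    by (rule continuous_on_subset) simp
qed

lemma I_right_scale: "I_right gam T (\<lambda>s. \<eta> s * c) t = I_right gam T \<eta> t * c"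
proof -
  have "(LINT \<tau>:{t<..<T}|lebesgue. (\<tau> - t) powr (gam - 1) * (\<eta> \<tau> * c))
      = (LINT \<tau>:{t<..<T}|lebesgue. ((\<tau> - t) powr (gam - 1) * \<eta> \<tau>) * c)"
    by (simp add: mult_ac)
  also have "\<dots> = (LINT \<tau>:{t<..<T}|lebesgue. (\<tau> - t) powr (gam - 1) * \<eta> \<tau>) * c"
    by (rule set_integral_mult_left)
  finally show ?thesis
    by (simp add: I_right_def)
qed

lemma I_right_nonneg:
  assumes "0 \<le> gam" "\<And>s. 0 \<le> \<eta> s"
  shows "0 \<le> I_right gam T \<eta> t"
proof (cases "gam = 0")
  case False
  then have "0 < Gamma gam"
    using assms by (intro Gamma_real_pos) auto
  moreover have "0 \<le> (LINT \<tau>:{t<..<T}|lebesgue. (\<tau> - t) powr (gam - 1) * \<eta> \<tau>)"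
    unfolding set_lebesgue_integral_def by (rule Bochner_Integration.integral_nonneg) (use assms in simp)
  ultimately show ?thesis
    using False by (simp add: I_right_def)
qed (use assms in \<open>simp add: I_right_def\<close>)

text \<open>
  Integrability of the kernel has to be known before \<open>I_right\<close> can be bounded from below, since a
  divergent integral would have the value \<open>0\<close>.
\<close>

lemma set_integrable_powr_singularity:
  fixes t T gam :: real
  assumes gam: "0 < gam" and f: "continuous_on UNIV f"
  shows "set_integrable lebesgue {t<..<T} (\<lambda>\<tau>. (\<tau> - t) powr (gam - 1) * f \<tau>)"
proof (cases "t < T")
  case True
  have "((\<lambda>x. x powr (gam - 1)) has_integral ((T - t) powr gam / gam)) {0..T - t}"
    using has_integral_powr_from_0[of "gam - 1" "T - t"] gam True by simp
  then have "(\<lambda>x. x powr (gam - 1)) integrable_on {0..T - t}"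
    by blast
  then have "(\<lambda>x. (x - t) powr (gam - 1)) integrable_on {t..T}"
    using integrable_on_shift_Icc_real[of "\<lambda>x. x powr (gam - 1)" "- t" t T] by (simp add: o_def)
  then have "(\<lambda>x. (x - t) powr (gam - 1)) absolutely_integrable_on {t..T}"
    by (rule nonnegative_absolutely_integrable_1) simp
  then have 1: "(\<lambda>x. (x - t) powr (gam - 1)) absolutely_integrable_on {t<..<T}"
    by (rule set_integrable_subset) auto
  have "compact (f ` {t..T})"
    using f by (intro compact_continuous_image) (auto intro: continuous_on_subset)
  then have "bounded (f ` {t<..<T})"
    by (rule bounded_subset[OF compact_imp_bounded]) auto
  moreover have "f \<in> borel_measurable (lebesgue_on {t<..<T})"
    using f by (intro continuous_imp_measurable_on_sets_lebesgue) (auto intro: continuous_on_subset)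
  ultimately have "(\<lambda>x. f x * (x - t) powr (gam - 1)) absolutely_integrable_on {t<..<T}"
    using 1 by (intro absolutely_integrable_bounded_measurable_product_real) auto
  then show ?thesis
    by (simp add: mult.commute)
qed simp

text \<open>
  The kernel \<open>(\<tau> - t)\<^bsup>\<gamma>-1\<^esup>\<close> decreases in \<open>\<tau>\<close>, so on \<open>(t, a)\<close> it is at least \<open>(a - t)\<^bsup>\<gamma>-1\<^esup>\<close>. What is
  left is the integral of a power. This loses only a constant against the exact Beta
  integral.
\<close>

lemma I_right_time_cutoff_lower:
  fixes n :: nat and gam :: real
  assumes gam: "0 \<le> gam" "gam < 1" and t: "0 < t" "t < a" "a < T"
  defines "c \<equiv> (if gam = 0 then 1 else 1 / Gamma gam) / (real n + 1)"
  shows "c * a powr gam * (1 - t / a) powr (n + gam) \<le> I_right gam T (time_cutoff a n) t"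
proof (cases "gam = 0")
  case True
  then have "I_right gam T (time_cutoff a n) t = (1 - t / a) ^ n"
    using t by (simp add: I_right_def time_cutoff_def tpow_eq_power)
  then show ?thesis
    using True t mult_right_mono[of "1 / (real n + 1)" 1 "(1 - t / a) ^ n"]
    by (simp add: c_def powr_realpow)
next
  case False
  let ?J = "LINT \<tau>:{t<..<T}|lebesgue. (\<tau> - t) powr (gam - 1) * time_cutoff a n \<tau>"
  let ?F = "\<lambda>\<tau>. - (a / (real n + 1)) * (1 - \<tau> / a) ^ Suc n"
  have G: "0 < Gamma gam"
    using False gam by (intro Gamma_real_pos) auto
  have z: "0 < 1 - t / a" using t by simp
  have fund: "((\<lambda>\<tau>. (1 - \<tau> / a) ^ n) has_integral (?F a - ?F t)) {t..a}"
  proof (rule fundamental_theorem_of_calculus)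
    fix x
    have "((\<lambda>\<tau>. 1 - \<tau> / a) has_real_derivative - (1 / a)) (at x within {t..a})"
      unfolding divide_inverse by (auto intro!: derivative_eq_intros)
    from DERIV_cmult[OF DERIV_power_Suc[OF this, of n], of "- (a / (real n + 1))"]
    moreover have "- (a / N) * (N * (- (1 / a) * u)) = u" if "N \<noteq> 0" for N u
      using t that by simp
    then have "- (a / (real n + 1)) * ((1 + real n) * (- (1 / a) * u)) = u" for u
      by (metis add.commute of_nat_Suc of_nat_neq_0)
    ultimately have "(?F has_real_derivative (1 - x / a) ^ n) (at x within {t..a})"
      by (simp only:)
    then show "(?F has_vector_derivative (1 - x / a) ^ n) (at x within {t..a})"
      by (simp add: has_real_derivative_iff_has_vector_derivative)
  qed (use t in auto)
  have int: "(\<lambda>\<tau>. (1 - \<tau> / a) ^ n) absolutely_integrable_on {t..a}"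
    using t has_integral_integrable[OF fund] by (intro nonnegative_absolutely_integrable_1) auto
  have "(LINT \<tau>:{t..a}|lebesgue. (1 - \<tau> / a) ^ n) = ?F a - ?F t"
    using int fund by (simp add: set_lebesgue_integral_eq_integral(2) integral_unique)
  also have "\<dots> = a / (real n + 1) * (1 - t / a) ^ Suc n"
    using t by simp
  finally have val: "(LINT \<tau>:{t..a}|lebesgue. (a - t) powr (gam - 1) * (1 - \<tau> / a) ^ n)
       = (a - t) powr (gam - 1) * (a / (real n + 1) * (1 - t / a) ^ Suc n)"
    by simp
  have "(LINT \<tau>:{t..a}|lebesgue. (a - t) powr (gam - 1) * (1 - \<tau> / a) ^ n) \<le> ?J"
    unfolding set_lebesgue_integral_def
  proof (rule integral_mono_AE)
    show "integrable lebesgue (\<lambda>x. indicat_real {t..a} x *\<^sub>R ((a - t) powr (gam - 1) * (1 - x / a) ^ n))"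
      using set_integrable_mult_right[OF int, of "(a - t) powr (gam - 1)"] by (simp add: set_integrable_def)
    show "integrable lebesgue (\<lambda>x. indicat_real {t<..<T} x *\<^sub>R ((x - t) powr (gam - 1) * time_cutoff a n x))"
      using set_integrable_powr_singularity[of gam "time_cutoff a n" t T] False gam continuous_on_time_cutoff
      by (simp add: set_integrable_def)
    \<comment> \<open>The endpoint is excluded because \<open>0 powr (gam - 1)\<close> is \<open>0\<close>, not infinite.\<close>
    have "AE x in lebesgue. x \<noteq> t"
      by (intro AE_completion AE_lborel_singleton)
    then show "AE x in lebesgue. indicat_real {t..a} x *\<^sub>R ((a - t) powr (gam - 1) * (1 - x / a) ^ n)
       \<le> indicat_real {t<..<T} x *\<^sub>R ((x - t) powr (gam - 1) * time_cutoff a n x)"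
    proof eventually_elim
      case (elim x)
      show ?case
      proof (cases "x \<in> {t..a}")
        case True
        then have "(a - t) powr (gam - 1) \<le> (x - t) powr (gam - 1)"
          using elim gam by (intro powr_mono2') auto
        moreover have "x \<in> {t<..<T}" "time_cutoff a n x = (1 - x / a) ^ n"
          using True elim t by (auto simp: time_cutoff_def tpow_eq_power)
        ultimately show ?thesis
          using True t by (auto intro!: mult_right_mono)
      next
        case False
        then show ?thesis by (simp add: time_cutoff_def)
      qed
    qed
  qed
  then have le: "(a - t) powr (gam - 1) * (a / (real n + 1) * (1 - t / a) ^ Suc n) \<le> ?J"
    unfolding val .
  have "a - t = a * (1 - t / a)" using t by (simp add: field_simps)
  then have "(a - t) powr (gam - 1) = a powr (gam - 1) * (1 - t / a) powr (gam - 1)"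
    using t z by (metis powr_mult)
  then have "(a - t) powr (gam - 1) * (a / (real n + 1) * (1 - t / a) ^ Suc n)
     = (a powr (gam - 1) * a powr 1) * ((1 - t / a) powr (gam - 1) * (1 - t / a) powr (real (Suc n))) / (real n + 1)"
    using t z by (simp add: powr_realpow del: power_Suc of_nat_Suc)
  also have "\<dots> = a powr gam * (1 - t / a) powr (n + gam) / (real n + 1)"
    unfolding powr_add[symmetric] by (simp add: add.commute)
  finally have "a powr gam * (1 - t / a) powr (n + gam) / (real n + 1) \<le> ?J"
    using le by simp
  then have "1 / Gamma gam * (a powr gam * (1 - t / a) powr (n + gam) / (real n + 1)) \<le> 1 / Gamma gam * ?J"
    using G by (intro mult_left_mono) auto
  then show ?thesis
    using False by (simp add: I_right_def c_def field_simps)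
qed

section \<open>Space-time boxes\<close>

lemma AE_lebesgue_snd:
  fixes P :: "'b::euclidean_space \<Rightarrow> bool"
  assumes "AE y in lebesgue. P y"
  shows "AE z in (lebesgue :: ('a::euclidean_space \<times> 'b) measure). P (snd z)"
proof -
  have "AE y in lborel. P y"
    using assms by (simp add: AE_completion_iff)
  then obtain N where N: "{y. \<not> P y} \<subseteq> N" "emeasure lborel N = 0" "N \<in> sets lborel"
    by (auto elim: AE_E)
  have "emeasure (lborel \<Otimes>\<^sub>M lborel) ((UNIV :: 'a set) \<times> N) = 0"
    using N by (subst lborel.emeasure_pair_measure_Times) auto
  then have "UNIV \<times> N \<in> null_sets (lborel :: ('a \<times> 'b) measure)"
    using N unfolding lborel_prod by (intro null_setsI) (auto simp: borel_Times)
  then have "AE z in (lborel :: ('a \<times> 'b) measure). P (snd z)"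
    by (rule AE_I') (use N in auto)
  then show ?thesis
    by (rule AE_completion)
qed

text \<open>
  Boxes suffice for all the volume estimates: one contains the support of the test function,
  another lies in the region where the test function is bounded below.
\<close>

definition spacetime_box :: "real \<Rightarrow> real \<Rightarrow> real \<Rightarrow> real \<Rightarrow> real \<Rightarrow> real \<Rightarrow> (real \<times> 'n::finite heis) set" where
  "spacetime_box t0 t1 l r w0 w1 = cbox (t0, \<chi> i. l, \<chi> i. l, w0) (t1, \<chi> i. r, \<chi> i. r, w1)"

lemma mem_spacetime_box:
  "(t, x, y, w) \<in> spacetime_box t0 t1 l r w0 w1 \<longleftrightarrow>
     t0 \<le> t \<and> t \<le> t1 \<and> (\<forall>i. l \<le> x $ i \<and> x $ i \<le> r) \<and> (\<forall>i. l \<le> y $ i \<and> y $ i \<le> r) \<and> w0 \<le> w \<and> w \<le> w1"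
  by (simp add: spacetime_box_def cbox_Pair_eq mem_box_cart)

lemma lmeasurable_spacetime_box: "spacetime_box t0 t1 l r w0 w1 \<in> lmeasurable"
  by (simp add: spacetime_box_def)

lemma measure_spacetime_box:
  assumes "t0 \<le> t1" "l \<le> r" "w0 \<le> w1"
  shows "measure lebesgue (spacetime_box t0 t1 l r w0 w1 :: (real \<times> 'n::finite heis) set)
    = (t1 - t0) * (r - l) ^ (2 * CARD('n)) * (w1 - w0)"
proof -
  have "(\<chi> i. l) \<in> cbox (\<chi> i. l) (\<chi> i. r :: real ^ 'n)"
    using assms by (simp add: mem_box_cart)
  then have "measure lborel (cbox (\<chi> i. l) (\<chi> i. r :: real ^ 'n)) = (r - l) ^ CARD('n)"
    by (subst content_cbox_cart) auto
  then show ?thesis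
    using assms by (simp add: spacetime_box_def content_Pair mult_2 power_add)
qed

lemma integral_const_on_lmeasurable:
  fixes c :: real
  assumes "B \<in> lmeasurable"
  shows "integrable lebesgue (\<lambda>z. c * indicat_real B z)"
    and "(LINT z|lebesgue. c * indicat_real B z) = c * measure lebesgue B"
  using assms by (auto intro!: integrable_mult_right simp: fmeasurable_def)

text \<open>
  The support of the test function at scale \<open>a\<close> sits in a box of volume of order \<open>a\<^sup>N\<^sup>+\<^sup>2\<close>, where
  \<open>N + 2 = 1 + Q/2\<close>.
\<close>

lemma bump_eq_0_off_box:
  assumes "0 < a" "(t, x, y, w) \<notin> spacetime_box 0 a (- sqrt a) (sqrt a) (2 * a) (4 * a)" "0 \<le> t" "t \<le> a"
  shows "dilated_paraboloid a (x, y, w) < 0"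
proof (rule ccontr)
  assume "\<not> dilated_paraboloid a (x, y, w) < 0"
  then have reg: "0 \<le> dilated_paraboloid a (x, y, w)" by simp
  note R = paraboloid_region[OF assms(1) reg]
  have "(norm x)\<^sup>2 + (norm y)\<^sup>2 \<le> a"
    using R(1) by (simp add: dot_square_norm)
  then have "(norm x)\<^sup>2 \<le> a" "(norm y)\<^sup>2 \<le> a"
    using zero_le_power2[of "norm x"] zero_le_power2[of "norm y"] by linarith+
  then have "norm x \<le> sqrt a" "norm y \<le> sqrt a"
    by (auto intro: real_le_rsqrt)
  then have "\<bar>x $ i\<bar> \<le> sqrt a" "\<bar>y $ i\<bar> \<le> sqrt a" for i
    using component_le_norm_cart order.trans by blast+
  then have "(t, x, y, w) \<in> spacetime_box 0 a (- sqrt a) (sqrt a) (2 * a) (4 * a)"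
    using R(3,4) assms by (simp add: mem_spacetime_box abs_le_iff minus_le_iff)
  then show False using assms by simp
qed

lemma bump_has_compact_support:
  assumes "0 < a" "0 < n"
  obtains K :: "'n::finite heis set" where "compact K" "\<And>\<xi>. \<xi> \<notin> K \<Longrightarrow> bump a n \<xi> = 0"
proof
  let ?K = "cbox (\<chi> i. - sqrt a, \<chi> i. - sqrt a, 2 * a) (\<chi> i. sqrt a, \<chi> i. sqrt a, 4 * a) :: 'n heis set"
  show "compact ?K" by (rule compact_cbox)
  fix \<xi> :: "'n heis" assume "\<xi> \<notin> ?K"
  moreover obtain x y w where \<xi>: "\<xi> = (x, y, w)" by (cases \<xi>) auto
  ultimately have "(0, x, y, w) \<notin> spacetime_box 0 a (- sqrt a) (sqrt a) (2 * a) (4 * a)"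
    by (simp add: spacetime_box_def cbox_Pair_eq)
  from bump_eq_0_off_box[OF assms(1) this] assms show "bump a n \<xi> = 0"
    by (simp add: \<xi> bump_def tpow_eq_0)
qed

section \<open>Upper and lower bounds at scale a\<close>

text \<open>
  Pointwise form of the main estimate. The time derivative and \<open>L\<^sub>H\<close> together contribute at most
  \<open>C/a\<close> times the weight times \<open>z\<^sup>n\<^sup>-\<^sup>1 G\<^sup>n\<^sup>-\<^sup>2\<close>, and \<open>test_integrand_young\<close> turns the product with \<open>|V|\<close>
  into the nonlinear term plus a remainder that is constant on the box.
\<close>

lemma test_integrand_absorbed:
  fixes \<xi> :: "'n::finite heis" and k :: nat and m gam p a T t V :: real
  defines "n \<equiv> Suc (Suc (Suc k))"
  defines "C \<equiv> 2 * real CARD('n) * real n * (15 * \<bar>m\<bar> + 36 * real n + 10) + real n"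
  defines "c \<equiv> (if gam = 0 then 1 else 1 / Gamma gam) / (real n + 1)"
  assumes n: "3 + 2 / (p - 1) \<le> real n" and p: "1 < p" and gam: "0 \<le> gam" "gam < 1"
    and m: "0 \<le> m" and a: "0 < a" "a < T" and t: "0 < t"
  shows "\<bar>V * (hnorm \<xi> powr (- 2 * m) * deriv (\<lambda>s. time_cutoff a n s * bump a n \<xi>) t
            - LH m (\<lambda>\<xi>. time_cutoff a n t * bump a n \<xi>) \<xi>)\<bar>
    \<le> hnorm \<xi> powr (- (p + 1) * m) * \<bar>V\<bar> powr p * I_right gam T (\<lambda>s. time_cutoff a n s * bump a n \<xi>) t
      + C * (C / c) powr (1 / (p - 1)) * a powr (- ((p + gam) / (p - 1))) * a powr (- m / 2)
          * indicat_real (spacetime_box 0 a (- sqrt a) (sqrt a) (2 * a) (4 * a)) (t, \<xi>)"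
    (is "\<bar>V * (?W * ?d - ?L)\<bar> \<le> ?B + ?K")
proof -
  let ?g = "dilated_paraboloid a \<xi>" and ?z = "1 - t / a"
  have der: "((\<lambda>s. time_cutoff a n s * bump a n \<xi>) has_real_derivative
      - (real n / a) * time_cutoff a (n - 1) t * bump a n \<xi>) (at t)"
    unfolding n_def by (rule DERIV_cmult_right) (use DERIV_time_cutoff[of a "Suc k" t] in simp)
  have d: "?d = - (real n / a) * time_cutoff a (n - 1) t * bump a n \<xi>"
    by (rule DERIV_imp_deriv[OF der])
  have L: "\<bar>?L\<bar> \<le> \<bar>time_cutoff a n t\<bar> * 2 * real CARD('n) * real n * (15 * \<bar>m\<bar> + 36 * real n + 10) / a
      * ?W * bump a (n - 2) \<xi>"
    unfolding n_def by (rule LH_bump_bound[OF a(1)])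
  have C: "0 < C"
    by (simp add: C_def n_def add_nonneg_pos)
  have c: "0 < c"
    using gam by (auto simp: c_def intro!: divide_pos_pos Gamma_real_pos)
  have I0: "0 \<le> I_right gam T (time_cutoff a n) t"
    using gam by (intro I_right_nonneg) (auto simp: time_cutoff_def)
  have B0: "0 \<le> ?B"
    using I0 by (simp add: I_right_scale bump_def)
  have K0: "0 \<le> ?K"
    using C c by simp
  show ?thesis
  proof (cases "t < a \<and> 0 < ?g")
    case False
    \<comment> \<open>Off the support of the test function \<open>LH_bump_bound\<close> itself gives \<open>L\<^sub>H \<phi> = 0\<close>, its right-hand side being \<open>0\<close>.\<close>
    then have "?L = 0 \<and> ?W * ?d = 0"
    proof (cases "0 < ?g")
      case True
      then have "time_cutoff a n t = 0" "time_cutoff a (n - 1) t = 0"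
        using False a by (auto simp: n_def intro!: time_cutoff_eq_0)
      then show ?thesis using L unfolding d by simp
    next
      case False
      then have "bump a n \<xi> = 0" "bump a (n - 2) \<xi> = 0"
        by (auto simp: n_def bump_def tpow_eq_0)
      then show ?thesis using L unfolding d by simp
    qed
    then have "?L = 0" "?W * ?d = 0"
      by blast+
    then have "\<bar>V * (?W * ?d - ?L)\<bar> = 0"
      by (simp only: diff_0_right mult_zero_right abs_zero)
    then show ?thesis
      using B0 K0 by linarith
  next
    case True
    then have ta: "t < a" and g: "0 < ?g" by auto
    note R = paraboloid_region[OF a(1) less_imp_le[OF g]]
    have z: "0 < ?z" "?z \<le> 1" using ta t a by auto
    have P: "0 < koranyi_quartic \<xi>" by (rule less_le_trans[OF _ R(5)]) (use a in simp)
    have h: "0 < hnorm \<xi>" using P by (simp add: hnorm_eq)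
    have tc: "time_cutoff a i t = ?z ^ i" for i
      using z by (simp add: time_cutoff_def tpow_eq_power)
    have bu: "bump a i \<xi> = ?g ^ i" for i
      using g by (simp add: bump_def tpow_eq_power)
    have zz: "?z ^ n \<le> ?z ^ (n - 1)" "?g ^ n \<le> ?g ^ (n - 2)"
      using z g R(7) by (auto intro!: power_decreasing)
    have 1: "\<bar>?W * ?d\<bar> \<le> real n / a * ?W * ?z ^ (n - 1) * ?g ^ (n - 2)"
    proof -
      have "\<bar>?W * ?d\<bar> = real n / a * ?W * ?z ^ (n - 1) * ?g ^ n"
        unfolding d unfolding tc bu using z g a by (simp add: abs_mult)
      also have "\<dots> \<le> real n / a * ?W * ?z ^ (n - 1) * ?g ^ (n - 2)"
        using z zz a by (intro mult_left_mono) auto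
      finally show ?thesis .
    qed
    have 2: "\<bar>?L\<bar> \<le> (C - real n) / a * ?W * ?z ^ (n - 1) * ?g ^ (n - 2)"
    proof -
      have "\<bar>?L\<bar> \<le> ?z ^ n * ((C - real n) / a * ?W * ?g ^ (n - 2))"
      proof -
        have "C - real n = 2 * real CARD('n) * real n * (15 * \<bar>m\<bar> + 36 * real n + 10)"
          by (simp add: C_def)
        moreover have "\<bar>?z ^ n\<bar> = ?z ^ n"
          using z by simp
        ultimately show ?thesis
          using L unfolding tc bu by (simp only: mult_ac times_divide_eq_right times_divide_eq_left)
      qed
      also have "\<dots> \<le> ?z ^ (n - 1) * ((C - real n) / a * ?W * ?g ^ (n - 2))"
        using zz a g by (intro mult_right_mono) (auto simp: C_def)
      finally show ?thesis by (simp add: mult_ac)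
    qed
    have "\<bar>?W * ?d - ?L\<bar> \<le> C / a * ?W * ?z ^ (n - 1) * ?g ^ (n - 2)"
      using abs_triangle_ineq4[of "?W * ?d" ?L] 1 2 by (simp add: diff_divide_distrib algebra_simps)
    then have "\<bar>V * (?W * ?d - ?L)\<bar> \<le> C / a * ?W * ?z ^ (n - 1) * ?g ^ (n - 2) * \<bar>V\<bar>"
      unfolding abs_mult by (subst mult.commute) (rule mult_right_mono, auto)
    also have "\<dots> \<le> c * hnorm \<xi> powr (- (p + 1) * m) * a powr gam * ?z powr (n + gam) * ?g ^ n * \<bar>V\<bar> powr p
       + C * (C / c) powr (1 / (p - 1)) * a powr (- ((p + gam) / (p - 1))) * hnorm \<xi> powr (- m)"
      by (rule test_integrand_young) (use h a z g R(7) C c p gam n in auto)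
    also have "\<dots> \<le> ?B + ?K"
    proof (rule add_mono)
      have "c * a powr gam * ?z powr (n + gam) \<le> I_right gam T (time_cutoff a n) t"
        unfolding c_def using gam t ta a by (intro I_right_time_cutoff_lower) auto
      then have "(c * a powr gam * ?z powr (n + gam)) * (hnorm \<xi> powr (- (p + 1) * m) * ?g ^ n * \<bar>V\<bar> powr p)
          \<le> I_right gam T (time_cutoff a n) t * (hnorm \<xi> powr (- (p + 1) * m) * ?g ^ n * \<bar>V\<bar> powr p)"
        using g by (intro mult_right_mono) auto
      then show "c * hnorm \<xi> powr (- (p + 1) * m) * a powr gam * ?z powr (n + gam) * ?g ^ n * \<bar>V\<bar> powr p \<le> ?B"
        unfolding I_right_scale bu by (simp only: mult_ac)
      have box: "(t, \<xi>) \<in> spacetime_box 0 a (- sqrt a) (sqrt a) (2 * a) (4 * a)"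
        using bump_eq_0_off_box[OF a(1), of t "fst \<xi>" "fst (snd \<xi>)" "snd (snd \<xi>)"] g t ta by auto
      have "hnorm \<xi> powr (- m) = koranyi_quartic \<xi> powr (- m / 4)"
        by (simp add: hnorm_powr)
      also have "\<dots> \<le> (a\<^sup>2) powr (- m / 4)"
        using R(5) a m by (intro powr_mono2') (auto intro: order.trans[of _ "4 * a\<^sup>2"])
      also have "\<dots> = a powr (- m / 2)"
        using a by (simp add: powr_powr flip: powr_numeral)
      finally have "C * (C / c) powr (1 / (p - 1)) * a powr (- ((p + gam) / (p - 1))) * hnorm \<xi> powr (- m)
        \<le> C * (C / c) powr (1 / (p - 1)) * a powr (- ((p + gam) / (p - 1))) * a powr (- m / 2)"
        using C by (intro mult_left_mono) auto
      then show "C * (C / c) powr (1 / (p - 1)) * a powr (- ((p + gam) / (p - 1))) * hnorm \<xi> powr (- m) \<le> ?K"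
        using box by simp
    qed
    finally show ?thesis .
  qed
qed

text \<open>
  The side length is chosen so that \<open>|x|\<^sup>2 + |y|\<^sup>2 \<le> a/4\<close>, and \<open>3 a \<le> w \<le> 7 a/2\<close> gives
  \<open>(w/a - 3)\<^sup>2 \<le> 1/4\<close>.
\<close>

lemma small_box_region:
  fixes x y :: "real ^ 'n::finite"
  assumes a: "0 < a"
    and box: "(t, x, y, w) \<in> spacetime_box (a / 4) (a / 2) 0 (sqrt (a / (8 * real CARD('n)))) (3 * a) (7 / 2 * a)"
  shows "1 / 2 \<le> dilated_paraboloid a (x, y, w)"
proof -
  have N: "0 < real CARD('n)" by simp
  have sq: "z \<bullet> z \<le> a / 8" if "\<forall>i. 0 \<le> z $ i \<and> z $ i \<le> sqrt (a / (8 * real CARD('n)))" for z :: "real ^ 'n"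
  proof -
    have "z \<bullet> z = (\<Sum>i\<in>UNIV. (z $ i)\<^sup>2)"
      by (simp add: inner_vec_def power2_eq_square)
    also have "\<dots> \<le> (\<Sum>i\<in>(UNIV :: 'n set). a / (8 * real CARD('n)))"
    proof (intro sum_mono)
      fix i
      have "(z $ i)\<^sup>2 \<le> (sqrt (a / (8 * real CARD('n))))\<^sup>2"
        using that by (intro power_mono) auto
      then show "(z $ i)\<^sup>2 \<le> a / (8 * real CARD('n))"
        using a by simp
    qed
    also have "\<dots> = a / 8" using N by simp
    finally show ?thesis .
  qed
  have "x \<bullet> x + y \<bullet> y \<le> a / 4"
    using sq[of x] sq[of y] box by (auto simp: mem_spacetime_box)
  then have 1: "(x \<bullet> x + y \<bullet> y) / a \<le> 1 / 4" using a by (simp add: field_simps)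
  have "0 \<le> w / a - 3" "w / a - 3 \<le> 1 / 2"
    using box a by (auto simp: mem_spacetime_box field_simps)
  then have "(w / a - 3)\<^sup>2 \<le> (1 / 2)\<^sup>2" by (intro power_mono)
  then have "(w / a - 3)\<^sup>2 \<le> 1 / 4" by (simp add: power2_eq_square)
  with 1 show ?thesis
    unfolding dilated_paraboloid_def fst_conv snd_conv by linarith
qed

text \<open>
  On the small box every factor of the forcing integrand is bounded below by its scaling size.
  Off that box the integrand is still nonnegative: where the bump is nonzero the Koranyi norm is at
  least \<open>1\<close>, so \<open>f\<close> is nonnegative there.
\<close>

lemma forcing_lower_bound:
  fixes \<xi> :: "'n::finite heis" and n :: nat
  assumes n: "0 < n" and m: "0 \<le> m" and beta: "0 \<le> beta" and alpha: "alpha < 0" and a: "1 \<le> a" "a < T" and eps: "0 < eps"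
    and f: "1 \<le> hnorm \<xi> \<longrightarrow> eps * hnorm \<xi> powr (- 2 * beta) \<le> f \<xi>"
  shows "eps * (17 powr (- m / 4) * 17 powr (- beta / 2) * (1 / 2) ^ n * (1 / 2) ^ n)
        * a powr (- m / 2) * a powr (alpha - beta)
       * indicat_real (spacetime_box (a / 4) (a / 2) 0 (sqrt (a / (8 * real CARD('n)))) (3 * a) (7 / 2 * a)) (t, \<xi>)
    \<le> indicat_real ({0<..<T} \<times> UNIV) (t, \<xi>) *
        (hnorm \<xi> powr (- m) * t powr alpha * f \<xi> * (time_cutoff a n t * bump a n \<xi>))"
    (is "?c * indicat_real ?Q _ \<le> ?E")
proof -
  have a0: "0 < a" using a by simp
  have pos: "1 \<le> hnorm \<xi> \<and> 4 * a\<^sup>2 \<le> koranyi_quartic \<xi> \<and> koranyi_quartic \<xi> \<le> 17 * a\<^sup>2" if "0 \<le> dilated_paraboloid a \<xi>"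
  proof -
    note R = paraboloid_region[OF a0 that]
    have "1 \<le> a\<^sup>2" using a by simp
    then have "1 \<le> koranyi_quartic \<xi>" using R(5) by linarith
    then have "1 \<le> hnorm \<xi>" by (simp add: hnorm_eq ge_one_powr_ge_zero)
    then show ?thesis using R by simp
  qed
  show ?thesis
  proof (cases "(t, \<xi>) \<in> ?Q")
    case False
    have "0 \<le> f \<xi> * bump a n \<xi>"
    proof (cases "0 \<le> dilated_paraboloid a \<xi>")
      case True
      then have "eps * hnorm \<xi> powr (- 2 * beta) \<le> f \<xi>" using pos f by blast
      moreover have "0 \<le> eps * hnorm \<xi> powr (- 2 * beta)" using eps by simp
      ultimately show ?thesis by (simp add: bump_def)
    next
      case False
      then show ?thesis using n by (simp add: bump_def tpow_eq_0)
    qed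
    then have "0 \<le> hnorm \<xi> powr (- m) * t powr alpha * time_cutoff a n t * (f \<xi> * bump a n \<xi>)"
      by (rule mult_nonneg_nonneg[rotated]) (auto simp: time_cutoff_def)
    then show ?thesis using False by (simp add: mult_ac indicator_def)
  next
    case True
    obtain x y w where \<xi>: "\<xi> = (x, y, w)" by (cases \<xi>) auto
    have t: "a / 4 \<le> t" "t \<le> a / 2" using True by (auto simp: \<xi> mem_spacetime_box)
    have g: "1 / 2 \<le> dilated_paraboloid a \<xi>"
      using small_box_region[OF a0 True[unfolded \<xi>]] by (simp add: \<xi>)
    then have P: "1 \<le> hnorm \<xi>" "4 * a\<^sup>2 \<le> koranyi_quartic \<xi>" "koranyi_quartic \<xi> \<le> 17 * a\<^sup>2"
      using pos by auto
    have P0: "0 < koranyi_quartic \<xi>" by (rule less_le_trans[OF _ P(2)]) (use a0 in simp)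
    have low: "17 powr (- r) * a powr (- 2 * r) \<le> koranyi_quartic \<xi> powr (- r)" if "0 \<le> r" for r
    proof -
      have "17 powr (- r) * a powr (- 2 * r) = (17 * a\<^sup>2) powr (- r)"
        using a0 by (simp add: powr_mult powr_powr flip: powr_numeral)
      also have "\<dots> \<le> koranyi_quartic \<xi> powr (- r)"
        using P P0 that by (intro powr_mono2') auto
      finally show ?thesis .
    qed
    have h1: "17 powr (- m / 4) * a powr (- m / 2) \<le> hnorm \<xi> powr (- m)"
      using low[of "m / 4"] m by (simp add: hnorm_powr)
    have "17 powr (- beta / 2) * a powr (- beta) \<le> hnorm \<xi> powr (- 2 * beta)"
      using low[of "beta / 2"] beta by (simp add: hnorm_powr)
    then have "eps * (17 powr (- beta / 2) * a powr (- beta)) \<le> eps * hnorm \<xi> powr (- 2 * beta)"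
      using eps by (intro mult_left_mono) auto
    then have h2: "eps * (17 powr (- beta / 2) * a powr (- beta)) \<le> f \<xi>"
      using f P(1) by linarith
    have h3: "a powr alpha \<le> t powr alpha"
      using t a0 alpha by (intro powr_mono2') auto
    have h4: "(1 / 2) ^ n \<le> time_cutoff a n t"
    proof -
      have "1 / 2 \<le> 1 - t / a" using t a0 by (simp add: field_simps)
      then show ?thesis unfolding time_cutoff_def tpow_def
        by (intro power_mono order.trans[OF _ max.cobounded2]) auto
    qed
    have h5: "(1 / 2) ^ n \<le> bump a n \<xi>"
      using g unfolding bump_def tpow_def by (intro power_mono) auto
    have "a powr (alpha - beta) = a powr alpha * a powr (- beta)"
      by (simp flip: powr_add)
    then have "?c = 17 powr (- m / 4) * a powr (- m / 2) * a powr alpha * (eps * (17 powr (- beta / 2) * a powr (- beta)))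
        * ((1 / 2) ^ n * (1 / 2) ^ n)"
      by (simp only: mult_ac)
    also have "\<dots> \<le> hnorm \<xi> powr (- m) * t powr alpha * f \<xi> * (time_cutoff a n t * bump a n \<xi>)"
    proof -
      have "0 \<le> f \<xi>" by (rule order.trans[OF _ h2]) (use eps in simp)
      then show ?thesis
        using h1 h2 h3 h4 h5 eps by (intro mult_mono) (auto simp: time_cutoff_def)
    qed
    also have "\<dots> = ?E"
      using t a0 a by simp
    finally show ?thesis using True by simp
  qed
qed

section \<open>The lifespan estimate\<close>

text \<open>
  Integrating the two pointwise bounds through the weak formulation. The nonlinear terms cancel,
  the initial term is nonnegative, and the factor \<open>a\<^bsup>N+2-m/2\<^esup>\<close> from volume and weight occurs on both
  sides.
\<close>

lemma forcing_size_bound: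
  fixes Q m lam gam alpha p beta :: real and k :: nat
  defines "n \<equiv> Suc (Suc (Suc k))"
  defines "C \<equiv> 2 * real CARD('n::finite) * real n * (15 * \<bar>m\<bar> + 36 * real n + 10) + real n"
  defines "c \<equiv> (if gam = 0 then 1 else 1 / Gamma gam) / (real n + 1)"
  defines "c' \<equiv> 17 powr (- m / 4) * 17 powr (- beta / 2) * (1 / 2) ^ n * (1 / 2) ^ n"
  assumes m: "m = hmu (hdim TYPE('n)) lam" "0 \<le> m"
    and p: "1 < p" and gam: "0 \<le> gam" "gam < 1" and alpha: "alpha < 0" and beta: "0 \<le> beta"
    and n: "3 + 2 / (p - 1) \<le> real n"
    and eps: "0 < eps" and u0: "AE \<xi> in lebesgue. 0 \<le> u0 \<xi>"
    and f: "AE \<xi> in lebesgue. 1 \<le> hnorm \<xi> \<longrightarrow> eps * hnorm \<xi> powr (- 2 * beta) \<le> f \<xi>"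
    and sol: "weak_solution lam gam alpha p u0 (f :: 'n heis \<Rightarrow> real) T u"
    and a: "1 \<le> a" "a < T"
  shows "eps * c' * a powr (alpha - beta) * ((1 / (8 * real CARD('n))) ^ CARD('n) / 8)
    \<le> C * (C / c) powr (1 / (p - 1)) * a powr (- ((p + gam) / (p - 1))) * (2 * 4 ^ CARD('n))"
proof -
  have a0: "0 < a" using a by simp
  define S where "S = {0<..<T} \<times> (UNIV :: 'n heis set)"
  define v where "v = (\<lambda>(t, \<xi>). hnorm \<xi> powr m * u t \<xi>)"
  define \<phi> where "\<phi> = (\<lambda>t (\<xi> :: 'n heis). time_cutoff a n t * bump a n \<xi>)"
  define A where "A = (\<lambda>(t, \<xi>). v (t, \<xi>) *
                (hnorm \<xi> powr (- 2 * m) * deriv (\<lambda>s. \<phi> s \<xi>) t - LH m (\<phi> t) \<xi>))"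
  define B where "B = (\<lambda>(t, \<xi>). hnorm \<xi> powr (- (p + 1) * m) * \<bar>v (t, \<xi>)\<bar> powr p *
                I_right gam T (\<lambda>s. \<phi> s \<xi>) t)"
  define D where "D = (\<lambda>\<xi>. hnorm \<xi> powr (- 2 * m) * (hnorm \<xi> powr m * u0 \<xi>) * \<phi> 0 \<xi>)"
  define E where "E = (\<lambda>(t, \<xi>). hnorm \<xi> powr (- m) * t powr alpha * f \<xi> * \<phi> t \<xi>)"
  obtain K :: "'n heis set" where K: "compact K" "\<And>\<xi>. \<xi> \<notin> K \<Longrightarrow> bump a n \<xi> = 0"
    by (rule bump_has_compact_support[OF a0, of n]) (auto simp: n_def)
  have "test_fun T \<phi>"
    unfolding \<phi>_def
  proof (rule test_fun_product[OF _ K])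
    show "C2 (bump a n :: 'n heis \<Rightarrow> real)"
      unfolding n_def by (rule C2_bump)
    show "(time_cutoff a n has_real_derivative - (real n / a) * time_cutoff a (n - 1) t) (at t)" for t
      using DERIV_time_cutoff[of a "Suc k" t] by (simp add: n_def)
    show "continuous_on UNIV (\<lambda>t. - (real n / a) * time_cutoff a (n - 1) t)"
      by (intro continuous_intros continuous_on_time_cutoff)
    show "time_cutoff a n t = 0" if "a < t" for t
      using a0 that by (intro time_cutoff_eq_0) (auto simp: n_def)
  qed (use a in auto)
  moreover have "\<forall>t\<in>{0..<T}. \<forall>\<xi>. 0 \<le> \<phi> t \<xi>"
    by (simp add: \<phi>_def time_cutoff_def bump_def)
  ultimately have "set_integrable lebesgue S A \<and> set_integrable lebesgue S B \<and>
            integrable lebesgue D \<and> set_integrable lebesgue S E \<and>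
            - (LINT z:S|lebesgue. A z) =
              (LINT z:S|lebesgue. B z) + (LINT \<xi>|lebesgue. D \<xi>) + (LINT z:S|lebesgue. E z)"
    using sol unfolding weak_solution_def Let_def m(1)[symmetric]
    unfolding A_def B_def D_def E_def v_def S_def by blast
  then have iA: "set_integrable lebesgue S A" and iB: "set_integrable lebesgue S B"
    and iE: "set_integrable lebesgue S E"
    and eq: "- (LINT z:S|lebesgue. A z) =
              (LINT z:S|lebesgue. B z) + (LINT \<xi>|lebesgue. D \<xi>) + (LINT z:S|lebesgue. E z)"
    by auto
  have D0: "0 \<le> (LINT \<xi>|lebesgue. D \<xi>)"
  proof (rule integral_nonneg_AE)
    show "AE \<xi> in lebesgue. 0 \<le> D \<xi>"
      using u0 by eventually_elim (auto simp: D_def \<phi>_def time_cutoff_def bump_def)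
  qed
  let ?big = "spacetime_box 0 a (- sqrt a) (sqrt a) (2 * a) (4 * a) :: (real \<times> 'n heis) set"
  let ?small = "spacetime_box (a / 4) (a / 2) 0 (sqrt (a / (8 * real CARD('n)))) (3 * a) (7 / 2 * a) :: (real \<times> 'n heis) set"
  define Ku where "Ku = C * (C / c) powr (1 / (p - 1)) * a powr (- ((p + gam) / (p - 1))) * a powr (- m / 2)"
  define Kl where "Kl = eps * c' * a powr (- m / 2) * a powr (alpha - beta)"
  have "(LINT z:S|lebesgue. - A z - B z) \<le> (LINT z|lebesgue. Ku * indicat_real ?big z)"
    unfolding set_lebesgue_integral_def
  proof (rule integral_mono)
    show "integrable lebesgue (\<lambda>z. indicat_real S z *\<^sub>R (- A z - B z))"
      using set_integral_diff(1)[OF set_integrable_mult_right[OF iA, of "-1"] iB]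
      by (simp add: set_integrable_def)
    show "integrable lebesgue (\<lambda>z. Ku * indicat_real ?big z)"
      by (rule integral_const_on_lmeasurable[OF lmeasurable_spacetime_box])
    fix z :: "real \<times> 'n heis"
    obtain t \<xi> where z: "z = (t, \<xi>)" by (cases z)
    have "0 \<le> C" by (simp add: C_def)
    moreover have "0 \<le> c" using gam by (auto simp: c_def)
    ultimately have Ku: "0 \<le> Ku" by (simp add: Ku_def)
    show "indicat_real S z *\<^sub>R (- A z - B z) \<le> Ku * indicat_real ?big z"
    proof (cases "z \<in> S")
      case True
      have "\<bar>A z\<bar> \<le> B z + Ku * indicat_real ?big z"
        unfolding z A_def B_def \<phi>_def Ku_def C_def c_def n_def prod.case
        by (rule test_integrand_absorbed)
          (use True z a a0 m(2) p gam n in \<open>auto simp: S_def n_def\<close>)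
      then show ?thesis using True by simp
    qed (use Ku in simp)
  qed
  moreover have "(LINT z:S|lebesgue. - A z - B z) = - (LINT z:S|lebesgue. A z) - (LINT z:S|lebesgue. B z)"
    using set_integral_diff(2)[OF set_integrable_mult_right[OF iA, of "-1"] iB]
      set_integral_mult_right[where a = "-1" and f = A] by simp
  ultimately have upper: "- (LINT z:S|lebesgue. A z) - (LINT z:S|lebesgue. B z) \<le> Ku * measure lebesgue ?big"
    by (simp only: integral_const_on_lmeasurable[OF lmeasurable_spacetime_box])
  have "(LINT z|lebesgue. Kl * indicat_real ?small z) \<le> (LINT z:S|lebesgue. E z)"
    unfolding set_lebesgue_integral_def
  proof (rule integral_mono_AE)
    show "integrable lebesgue (\<lambda>z. Kl * indicat_real ?small z)"
      by (rule integral_const_on_lmeasurable[OF lmeasurable_spacetime_box])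
    show "integrable lebesgue (\<lambda>z. indicat_real S z *\<^sub>R E z)"
      using iE by (simp add: set_integrable_def)
    show "AE z in lebesgue. Kl * indicat_real ?small z \<le> indicat_real S z *\<^sub>R E z"
      using AE_lebesgue_snd[OF f]
    proof eventually_elim
      case (elim z)
      obtain t \<xi> where z: "z = (t, \<xi>)" by (cases z)
      have "0 < n" by (simp add: n_def)
      from forcing_lower_bound[OF this m(2) beta alpha a eps, of \<xi> f t] elim
      show ?case
        unfolding z Kl_def c'_def S_def E_def \<phi>_def prod.case snd_conv real_scaleR_def by blast
    qed
  qed
  then have lower: "Kl * measure lebesgue ?small \<le> (LINT z:S|lebesgue. E z)"
    by (simp only: integral_const_on_lmeasurable[OF lmeasurable_spacetime_box])
  have "Kl * measure lebesgue ?small \<le> Ku * measure lebesgue ?big"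
    using lower upper eq D0 by linarith
  moreover have "measure lebesgue ?small = (1 / (8 * real CARD('n))) ^ CARD('n) / 8 * a ^ (CARD('n) + 2)"
  proof -
    have "measure lebesgue ?small
      = (a / 2 - a / 4) * (sqrt (a / (8 * real CARD('n))) - 0) ^ (2 * CARD('n)) * (7 / 2 * a - 3 * a)"
      by (rule measure_spacetime_box) (use a0 in auto)
    also have "\<dots> = a / 4 * (a / (8 * real CARD('n))) ^ CARD('n) * (a / 2)"
    proof -
      have "a / 2 - a / 4 = a / 4" "7 / 2 * a - 3 * a = a / 2"
        by simp_all
      moreover have "(sqrt (a / (8 * real CARD('n))))\<^sup>2 = a / (8 * real CARD('n))"
        using a0 by simp
      ultimately show ?thesis
        by (simp only: power_mult diff_0_right)
    qed
    also have "\<dots> = (1 / (8 * real CARD('n))) ^ CARD('n) / 8 * a ^ (CARD('n) + 2)"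
      using a0 by (simp add: power_divide power_add power2_eq_square mult_ac)
    finally show ?thesis .
  qed
  moreover have "measure lebesgue ?big = 2 * 4 ^ CARD('n) * a ^ (CARD('n) + 2)"
  proof -
    have "measure lebesgue ?big = a * ((2 * sqrt a)\<^sup>2) ^ CARD('n) * (2 * a)"
      using a0 by (subst measure_spacetime_box) (auto simp: power_mult)
    also have "\<dots> = 2 * 4 ^ CARD('n) * a ^ (CARD('n) + 2)"
      using a0 by (simp add: power_mult_distrib power_add power2_eq_square)
    finally show ?thesis .
  qed
  ultimately have "(a powr (- m / 2) * a ^ (CARD('n) + 2)) * (eps * c' * a powr (alpha - beta) * ((1 / (8 * real CARD('n))) ^ CARD('n) / 8))
    \<le> (a powr (- m / 2) * a ^ (CARD('n) + 2)) * (C * (C / c) powr (1 / (p - 1)) * a powr (- ((p + gam) / (p - 1))) * (2 * 4 ^ CARD('n)))"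
    unfolding Kl_def Ku_def by (simp only: mult_ac)
  then show ?thesis
    by (rule mult_left_le_imp_le) (use a0 in simp)
qed

lemma sup_existence_time_le:
  assumes "\<And>T u. 0 < T \<Longrightarrow> weak_solution lam gam alpha p u0 f T u \<Longrightarrow> T \<le> b"
  shows "max_existence_time lam gam alpha p u0 f \<le> ereal b"
  unfolding max_existence_time_def using assms by (auto intro!: Sup_least)

theorem theorem5p1:
  fixes Q m lam gam alpha p beta eps0 :: real
  assumes "Q = hdim TYPE('n::finite)"
    and "0 < lam" and "lam < ((Q - 2) / 2)\<^sup>2"
    and "m = hmu Q lam"
    and "0 \<le> gam" and "gam < 1"
    and "-1 < alpha" and "alpha < 0"
    and "1 < p" and "p < (Q + 2 * gam - m - 2 * alpha) / (Q - 2 - m - 2 * alpha)"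
    and "Q / 2 - m / 2 < beta" and "beta < (gam + p) / (p - 1) + alpha"
    and "0 < eps0"
  shows "\<exists>C>0. \<forall>eps u0 f.
    0 < eps \<and> eps \<le> eps0 \<and>
    essentially_bounded (u0 :: 'n heis \<Rightarrow> real) \<and> (AE \<xi> in lebesgue. 0 \<le> u0 \<xi>) \<and>
    integrable lebesgue (\<lambda>\<xi>. hnorm \<xi> powr (- m) * f \<xi>) \<and>
    0 < (LINT \<xi>|lebesgue. hnorm \<xi> powr (- m) * f \<xi>) \<and>
    (AE \<xi> in lebesgue. 1 \<le> hnorm \<xi> \<longrightarrow> eps * hnorm \<xi> powr (- 2 * beta) \<le> f \<xi>) \<longrightarrow>
    (\<forall>T u_eps. 0 < T \<and> weak_solution lam gam alpha p u0 f T u_eps \<longrightarrow>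
      max_existence_time lam gam alpha p u0 f
        \<le> ereal (C * eps powr (inverse (beta - (gam + p) / (p - 1) - alpha))))"
proof -
  have Q: "0 \<le> Q - 2" using assms(1) by (simp add: hdim_def)
  have "sqrt (((Q - 2) / 2)\<^sup>2 - lam) \<le> sqrt (((Q - 2) / 2)\<^sup>2)"
    by (rule real_sqrt_le_mono) (use \<open>0 < lam\<close> in simp)
  then have m0: "0 \<le> m"
    using Q \<open>m = hmu Q lam\<close> by (simp add: hmu_def)
  have mQ: "m \<le> (Q - 2) / 2"
    using \<open>m = hmu Q lam\<close> \<open>lam < ((Q - 2) / 2)\<^sup>2\<close>
      real_sqrt_ge_zero[of "((Q - 2) / 2)\<^sup>2 - lam"] unfolding hmu_def by linarith
  have beta: "0 \<le> beta"
    using mQ Q \<open>Q / 2 - m / 2 < beta\<close> by simp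
  obtain k :: nat where k: "2 / (p - 1) \<le> real k"
    using real_arch_simple by blast
  define n where "n = Suc (Suc (Suc k))"
  have n: "3 + 2 / (p - 1) \<le> real n"
    using k by (simp add: n_def)
  define \<sigma> where "\<sigma> = (gam + p) / (p - 1) + alpha - beta"
  have \<sigma>: "0 < \<sigma>" using assms(12) by (simp add: \<sigma>_def)
  have inv: "inverse (beta - (gam + p) / (p - 1) - alpha) = - (1 / \<sigma>)"
  proof -
    have "beta - (gam + p) / (p - 1) - alpha = - \<sigma>" by (simp add: \<sigma>_def)
    then show ?thesis by (simp add: divide_inverse)
  qed
  define C1 where "C1 = 2 * real CARD('n) * real n * (15 * \<bar>m\<bar> + 36 * real n + 10) + real n"
  define c where "c = (if gam = 0 then 1 else 1 / Gamma gam) / (real n + 1)"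
  define l where "l = 17 powr (- m / 4) * 17 powr (- beta / 2) * (1 / 2) ^ n * (1 / 2) ^ n * ((1 / (8 * real CARD('n))) ^ CARD('n) / 8)"
  define up where "up = C1 * (C1 / c) powr (1 / (p - 1)) * (2 * 4 ^ CARD('n))"
  have l: "0 < l" by (simp add: l_def)
  have C1: "0 < C1" by (simp add: C1_def n_def add_nonneg_pos)
  have c: "0 < c" using assms(5) by (auto simp: c_def intro!: divide_pos_pos Gamma_real_pos)
  have up: "0 < up" using C1 c by (simp add: up_def)
  \<comment> \<open>The second entry makes \<open>b \<ge> 1\<close> below, so every scale beyond \<open>b\<close> is admissible.\<close>
  define M where "M = max (up / l) eps0"
  have M: "up / l \<le> M" "eps0 \<le> M" "0 < M" using \<open>0 < eps0\<close> by (auto simp: M_def)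
  have key: "T \<le> M powr (1 / \<sigma>) * eps powr (- (1 / \<sigma>))"
    if eps: "0 < eps" "eps \<le> eps0" and u0: "AE \<xi> in lebesgue. 0 \<le> u0 \<xi>"
      and f: "AE \<xi> in lebesgue. 1 \<le> hnorm \<xi> \<longrightarrow> eps * hnorm \<xi> powr (- 2 * beta) \<le> f \<xi>"
      and sol: "weak_solution lam gam alpha p u0 (f :: 'n heis \<Rightarrow> real) T u"
    for eps u0 f T u
  proof (rule ccontr)
    define b where "b = (M / eps) powr (1 / \<sigma>)"
    assume "\<not> ?thesis"
    moreover have "b = M powr (1 / \<sigma>) * eps powr (- (1 / \<sigma>))"
      using eps M by (simp add: b_def powr_divide powr_minus_divide)
    ultimately have "b < T"
      by simp
    then obtain a where a: "b < a" "a < T"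
      using dense by blast
    have "1 \<le> b"
      unfolding b_def using eps M \<sigma> by (intro ge_one_powr_ge_zero) auto
    then have a1: "1 \<le> a" "0 < a" using a by auto
    have "eps * (17 powr (- m / 4) * 17 powr (- beta / 2) * (1 / 2) ^ n * (1 / 2) ^ n) * a powr (alpha - beta) *
         ((1 / (8 * real CARD('n))) ^ CARD('n) / 8)
      \<le> C1 * (C1 / c) powr (1 / (p - 1)) * a powr (- ((p + gam) / (p - 1))) * (2 * 4 ^ CARD('n))"
      unfolding C1_def c_def n_def
      by (rule forcing_size_bound[OF _ m0 _ _ _ _ beta _ eps(1) u0 f sol a1(1) a(2)])
        (use assms n in \<open>auto simp: n_def\<close>)
    then have "eps * l * a powr (alpha - beta) \<le> up * a powr (- ((p + gam) / (p - 1)))"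
      unfolding l_def up_def by (simp only: mult_ac)
    then have "eps * l * a powr (alpha - beta) * a powr ((p + gam) / (p - 1)) \<le> up * a powr (- ((p + gam) / (p - 1))) * a powr ((p + gam) / (p - 1))"
      by (rule mult_right_mono) simp
    then have "eps * l * a powr (alpha - beta + (p + gam) / (p - 1)) \<le> up"
      using a1 by (simp add: mult.assoc flip: powr_add)
    also have "alpha - beta + (p + gam) / (p - 1) = \<sigma>"
      by (simp add: \<sigma>_def add.commute)
    finally have "a powr \<sigma> \<le> up / l / eps"
      using l eps by (simp add: field_simps)
    also have "\<dots> \<le> M / eps"
      using M eps by (intro divide_right_mono) auto
    also have "\<dots> = b powr \<sigma>"
      using \<sigma> M eps by (simp add: b_def powr_powr)
    finally have "a powr \<sigma> \<le> b powr \<sigma>" .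
    moreover have "b powr \<sigma> < a powr \<sigma>"
      using a \<open>1 \<le> b\<close> \<sigma> by (intro powr_less_mono2) auto
    ultimately show False by simp
  qed
  show ?thesis
  proof (intro exI[of _ "M powr (1 / \<sigma>)"] conjI allI impI)
    show "0 < M powr (1 / \<sigma>)" using M by simp
  qed (use key inv in \<open>auto intro!: sup_existence_time_le\<close>)
qed

end
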